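(* Let $A=\{a_1,\ldots,a_m\}$ be a finite set of distinct real numbers. For every non-negative integer $n$, the characteristic polynomial of $\mathcal{B}_n^A$ satisfies \[ \chi_{\mathcal{B}_n^A}(t)=\sum_{l=0}^n(-1)^{n-l}\,r_l(\mathcal{B}_n^A)\binom{t}{l}, \] with the convention $\chi_{\mathcal{B}_0^A}(t)=1$.
   Context: For a finite set $A$ of real numbers and $n\ge 0$, $\mathcal{B}_n^A$ is the hyperplane arrangement in $\mathbb{R}^n$ consisting of the hyperplanes $x_i-x_j=a$ for all $1\le i<j\le n$ and $a\in A$. The characteristic polynomial of an arrangement $\mathcal{A}$ in $\mathbb{R}^n$ is $\chi_{\mathcal{A}}(t)=\sum (-1)^{|\mathcal{B}|}t^{\dim(\bigcap_{H\in\mathcal{B}}H)}$, the sum over all subsets $\mathcal{B}\subseteq\mathcal{A}$ with $\bigcap_{H\in\mathcal{B}}H\neq\emptyset$ (the empty intersection being $\mathbb{R}^n$). A region is a connected component of the complement of the union of the hyperplanes. The level $l(X)$ of $X\subseteq\mathbb{R}^n$ is the smallest non-negative integer $l$ such that there exist a linear subspace $W$ of dimension $l$ and $r>0$ with $X\subseteq\{\bm x:\min_{\bm w\in W}\|\bm x-\bm w\|\le r\}$. $r_l(\mathcal{A})$ is the number of regions of level $l$, with $r_0=1$ for the arrangement in $\mathbb{R}^0$. $\binom{t}{l}=t(t-1)\cdots(t-l+1)/l!$.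
   Formalization: The set A is assumed nonempty (m ≥ 1): for A empty and n = 2 the arrangement is empty, so the characteristic polynomial is t², while the right-hand side is t(t−1)/2, so the identity fails. *)

theory Defs
  imports
    "HOL-Analysis.Analysis"
    "HOL-Library.Function_Algebras"
    "HOL-Computational_Algebra.Polynomial"
begin

text \<open>
  For a dimension \<open>n\<close> that is an ordinary natural number (including \<open>0\<close>), \<open>\<real>\<^sup>n\<close> is the library space
  \<^term>\<open>Euclidean_space n\<close>: the functions \<open>x :: nat \<Rightarrow> real\<close> with \<open>x i = 0\<close> for all \<open>i \<ge> n\<close>,
  so the coordinates \<open>x\<^sub>1, \<dots>, x\<^sub>n\<close> are \<open>x 0, \<dots>, x (n - 1)\<close>. The pointwise real vector space
  structure on functions supplies \<^const>\<open>subspace\<close> and \<^const>\<open>dim\<close>.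
\<close>

instantiation "fun" :: (type, real_vector) real_vector
begin

definition scaleR_fun_def: "scaleR r f = (\<lambda>x. scaleR r (f x))"

instance
  by standard (simp_all add: scaleR_fun_def fun_eq_iff scaleR_add_left scaleR_add_right)

end

definition euclid_dist :: "nat \<Rightarrow> (nat \<Rightarrow> real) \<Rightarrow> (nat \<Rightarrow> real) \<Rightarrow> real" where
  "euclid_dist n x y = L2_set (\<lambda>i. x i - y i) {..<n}"

text \<open>The library's \<^const>\<open>aff_dim\<close> is restricted to \<^class>\<open>euclidean_space\<close>; the dimension of a
  nonempty affine subspace is that of its space of differences.\<close>

definition affine_dim :: "(nat \<Rightarrow> real) set \<Rightarrow> nat" where
  "affine_dim F = dim {x - y | x y. x \<in> F \<and> y \<in> F}"

definition flat :: "nat \<Rightarrow> (nat \<Rightarrow> real) set set \<Rightarrow> (nat \<Rightarrow> real) set" where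
  "flat n B = topspace (Euclidean_space n) \<inter> \<Inter>B"

definition arrangement_poly :: "nat \<Rightarrow> (nat \<Rightarrow> real) set set \<Rightarrow> real poly" where
  "arrangement_poly n \<A> =
    (\<Sum>B | B \<subseteq> \<A> \<and> flat n B \<noteq> {}. monom ((-1) ^ card B) (affine_dim (flat n B)))"

definition regions :: "nat \<Rightarrow> (nat \<Rightarrow> real) set set \<Rightarrow> (nat \<Rightarrow> real) set set" where
  "regions n \<A> = connected_components_of (subtopology (Euclidean_space n) (- \<Union>\<A>))"

text \<open>The infimum below is attained, \<open>W\<close> being a finite-dimensional subspace.\<close>

definition level :: "nat \<Rightarrow> (nat \<Rightarrow> real) set \<Rightarrow> nat" where
  "level n X = (LEAST l. \<exists>W r. subspace W \<and> W \<subseteq> topspace (Euclidean_space n) \<and> dim W = l \<and> r > 0 \<and>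
     X \<subseteq> {x \<in> topspace (Euclidean_space n). (INF w\<in>W. euclid_dist n x w) \<le> r})"

definition num_regions :: "nat \<Rightarrow> (nat \<Rightarrow> real) set set \<Rightarrow> nat \<Rightarrow> nat" where
  "num_regions n \<A> l = card {R \<in> regions n \<A>. level n R = l}"

definition difference_arrangement :: "nat \<Rightarrow> real set \<Rightarrow> (nat \<Rightarrow> real) set set" where
  "difference_arrangement n A =
    {{x \<in> topspace (Euclidean_space n). x i - x j = a} | i j a. i < j \<and> j < n \<and> a \<in> A}"

lemma topspace_Euclidean_space_0: "topspace (Euclidean_space 0) = {0}"
  by (auto simp: topspace_Euclidean_space fun_eq_iff)

lemma difference_arrangement_0: "difference_arrangement 0 A = {}"
  by (simp add: difference_arrangement_def)

lemma dim_singleton_zero: "dim {0 :: nat \<Rightarrow> real} = 0"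
  by (rule dim_unique[of "{}"]) (auto simp: independent_empty)

text \<open>The conventions for \<open>n = 0\<close> are consequences of the definitions.\<close>

lemma arrangement_poly_0: "arrangement_poly 0 (difference_arrangement 0 A) = 1"
proof -
  have "flat 0 {} = {0}"
    by (simp add: flat_def topspace_Euclidean_space_0)
  moreover have "{B. B \<subseteq> {} \<and> flat 0 B \<noteq> {}} = {{}}"
    using calculation by auto
  moreover have "affine_dim {0} = 0"
    by (simp add: affine_dim_def dim_singleton_zero)
  ultimately show ?thesis
    by (simp add: arrangement_poly_def difference_arrangement_0)
qed

lemma num_regions_0: "num_regions 0 (difference_arrangement 0 A) 0 = 1"
proof -
  have "regions 0 {} = {{0}}"
  proof -
    have "connected_component_of_set (Euclidean_space 0) 0 = {0}"
      using connected_component_of_subset_topspace[of "Euclidean_space 0" 0]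
        connected_component_of_refl[of "Euclidean_space 0" 0]
      by (auto simp: topspace_Euclidean_space_0)
    then show ?thesis
      by (simp add: regions_def connected_components_of_def topspace_Euclidean_space_0)
  qed
  moreover have "level 0 {0} = 0"
    unfolding level_def
    by (rule Least_eq_0, rule exI[of _ "{0}"], rule exI[of _ 1])
      (simp add: topspace_Euclidean_space_0 euclid_dist_def dim_singleton_zero)
  ultimately have "{R \<in> regions 0 {}. level 0 R = 0} = {{0}}"
    by auto
  then show ?thesis
    by (simp add: num_regions_def difference_arrangement_0)
qed

end

theory Submission
  imports Defs
begin

text \<open>
  Both sides are polynomials in \<open>t\<close>, so it suffices to compare them at \<open>t = -k\<close> for integers
  \<open>k \<ge> 1\<close>. For \<open>f : {1..n} \<rightarrow> {1..k}\<close> let \<open>\<A>\<^sub>f\<close> consist of the hyperplanes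
  \<open>x\<^sub>i - x\<^sub>j = a\<close> with \<open>f i = f j\<close>. A central subarrangement with flat of dimension \<open>d\<close> is
  contained in \<open>\<A>\<^sub>f\<close> for exactly \<open>k\<^sup>d\<close> functions \<open>f\<close>; hence, by Zaslavsky's
  theorem, \<open>(-1)\<^sup>n \<chi>(-k)\<close> is the sum over all \<open>f\<close> of the number of regions of \<open>\<A>\<^sub>f\<close>.

  Attach to a region of the full arrangement the digraph with an edge \<open>i \<rightarrow> j\<close> whenever \<open>x\<^sub>i - x\<^sub>j\<close>
  is bounded below on it. Pushing the blocks of \<open>f\<close> far apart identifies the regions of \<open>\<A>\<^sub>f\<close> with
  the regions of the full arrangement along whose digraph \<open>f\<close> is weakly increasing. As \<open>A\<close> is
  nonempty, any two vertices are joined by an edge, so the strong components are linearly ordered;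
  if there are \<open>m\<close> of them, there are \<open>k + m - 1\<close> choose \<open>m\<close> weakly increasing \<open>f\<close>, which is
  \<open>(-1)\<^sup>m\<close> times \<open>-k\<close> choose \<open>m\<close>. Finally \<open>m\<close> is the level of the region: the directions in which
  the region is unbounded span the space of vectors constant on strong components.
\<close>

section \<open>Linear algebra in \<open>\<real>\<^sup>n\<close>\<close>

lemma fun_sum_apply: "(\<Sum>i\<in>I. f i) x = (\<Sum>i\<in>I. f i x)"
  for f :: "'i \<Rightarrow> 'b \<Rightarrow> 'c::comm_monoid_add"
  by (induction I rule: infinite_finite_induct) auto

text \<open>One notion covers three spaces: all of \<open>\<real>\<^sup>n\<close> when
  \<open>\<rho>\<close> is the identity, the direction space of a flat when \<open>\<rho>\<close> is
  \<open>edge_class\<close>, and the axis of a tube around a region when \<open>\<rho>\<close> ranks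
  the strong components.\<close>

definition fibre_constant :: "nat \<Rightarrow> (nat \<Rightarrow> 'b) \<Rightarrow> (nat \<Rightarrow> real) set" where
  "fibre_constant n \<rho> =
    {y \<in> topspace (Euclidean_space n). \<forall>i<n. \<forall>j<n. \<rho> i = \<rho> j \<longrightarrow> y i = y j}"

definition fibre_indicator :: "nat \<Rightarrow> (nat \<Rightarrow> 'b) \<Rightarrow> 'b \<Rightarrow> nat \<Rightarrow> real" where
  "fibre_indicator n \<rho> b = (\<lambda>i. if i < n \<and> \<rho> i = b then 1 else 0)"

lemma fibre_constantI:
  assumes "\<And>i. n \<le> i \<Longrightarrow> y i = 0"
    and "\<And>i j. i < n \<Longrightarrow> j < n \<Longrightarrow> \<rho> i = \<rho> j \<Longrightarrow> y i = y j"
  shows "y \<in> fibre_constant n \<rho>"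
  using assms unfolding fibre_constant_def topspace_Euclidean_space by blast

lemma fibre_constantD:
  assumes "y \<in> fibre_constant n \<rho>"
  shows "n \<le> i \<Longrightarrow> y i = 0" "i < n \<Longrightarrow> j < n \<Longrightarrow> \<rho> i = \<rho> j \<Longrightarrow> y i = y j"
  using assms unfolding fibre_constant_def topspace_Euclidean_space by blast+

lemma subspace_fibre_constant: "subspace (fibre_constant n \<rho>)"
proof (rule subspaceI)
  fix x y c
  assume x: "x \<in> fibre_constant n \<rho>"
  show "c *\<^sub>R x \<in> fibre_constant n \<rho>"
    by (rule fibre_constantI)
      (auto simp: scaleR_fun_def fibre_constantD(1)[OF x] dest: fibre_constantD(2)[OF x])
  assume y: "y \<in> fibre_constant n \<rho>"
  show "x + y \<in> fibre_constant n \<rho>"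
  proof (rule fibre_constantI)
    fix i j assume "i < n" "j < n" "\<rho> i = \<rho> j"
    then show "(x + y) i = (x + y) j"
      using fibre_constantD(2)[OF x, of i j] fibre_constantD(2)[OF y, of i j] by simp
  qed (simp add: fibre_constantD(1)[OF x] fibre_constantD(1)[OF y])
qed (simp add: fibre_constantI)

lemma fibre_indicator_in: "fibre_indicator n \<rho> b \<in> fibre_constant n \<rho>"
  by (rule fibre_constantI) (auto simp: fibre_indicator_def)

lemma fibre_constant_eq_sum:
  assumes "y \<in> fibre_constant n \<rho>"
  shows "y = (\<Sum>b\<in>\<rho> ` {..<n}. y (inv_into {..<n} \<rho> b) *\<^sub>R fibre_indicator n \<rho> b)"
proof
  fix i
  have "(\<Sum>b\<in>\<rho> ` {..<n}. y (inv_into {..<n} \<rho> b) *\<^sub>R fibre_indicator n \<rho> b) i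
      = (\<Sum>b\<in>\<rho> ` {..<n}. if b = \<rho> i then (if i < n then y (inv_into {..<n} \<rho> b) else 0) else 0)"
    unfolding fun_sum_apply by (rule sum.cong) (auto simp: scaleR_fun_def fibre_indicator_def)
  also have "\<dots> = (if \<rho> i \<in> \<rho> ` {..<n} \<and> i < n then y (inv_into {..<n} \<rho> (\<rho> i)) else 0)"
    by (subst sum.delta) auto
  also have "\<dots> = y i"
  proof (cases "i < n")
    case True
    then have "\<rho> i \<in> \<rho> ` {..<n}" by simp
    then have "inv_into {..<n} \<rho> (\<rho> i) < n" "\<rho> (inv_into {..<n} \<rho> (\<rho> i)) = \<rho> i"
      using inv_into_into[of "\<rho> i" \<rho> "{..<n}"] f_inv_into_f[of "\<rho> i" \<rho> "{..<n}"] by auto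
    then show ?thesis
      using True fibre_constantD(2)[OF assms, of "inv_into {..<n} \<rho> (\<rho> i)" i] by simp
  next
    case False
    then show ?thesis using fibre_constantD(1)[OF assms, of i] by simp
  qed
  finally show "y i = (\<Sum>b\<in>\<rho> ` {..<n}. y (inv_into {..<n} \<rho> b) *\<^sub>R fibre_indicator n \<rho> b) i"
    by simp
qed

lemma span_fibre_indicator:
  "span (fibre_indicator n \<rho> ` \<rho> ` {..<n}) = fibre_constant n \<rho>"
proof
  show "span (fibre_indicator n \<rho> ` \<rho> ` {..<n}) \<subseteq> fibre_constant n \<rho>"
    by (rule span_minimal) (auto simp: fibre_indicator_in subspace_fibre_constant)
  show "fibre_constant n \<rho> \<subseteq> span (fibre_indicator n \<rho> ` \<rho> ` {..<n})"
  proof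
    fix y assume "y \<in> fibre_constant n \<rho>"
    note y_eq = fibre_constant_eq_sum[OF this]
    show "y \<in> span (fibre_indicator n \<rho> ` \<rho> ` {..<n})"
      by (subst y_eq, rule span_sum, rule span_scale, rule span_base) simp
  qed
qed

lemma inj_on_fibre_indicator: "inj_on (fibre_indicator n \<rho>) (\<rho> ` {..<n})"
proof (rule inj_onI)
  fix b c
  assume b: "b \<in> \<rho> ` {..<n}" and eq: "fibre_indicator n \<rho> b = fibre_indicator n \<rho> c"
  from b obtain i where "i < n" "\<rho> i = b" by auto
  then show "b = c"
    using fun_cong[OF eq, of i] by (auto simp: fibre_indicator_def split: if_splits)
qed

lemma independent_fibre_indicator: "independent (fibre_indicator n \<rho> ` \<rho> ` {..<n})"
proof (rule independent_if_scalars_zero)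
  fix u v
  assume sum0: "(\<Sum>x\<in>fibre_indicator n \<rho> ` \<rho> ` {..<n}. u x *\<^sub>R x) = 0"
    and "v \<in> fibre_indicator n \<rho> ` \<rho> ` {..<n}"
  then obtain i where i: "i < n" and v: "v = fibre_indicator n \<rho> (\<rho> i)" by auto
  have "(\<Sum>x\<in>fibre_indicator n \<rho> ` \<rho> ` {..<n}. u x *\<^sub>R x) i
      = (\<Sum>b\<in>\<rho> ` {..<n}. if b = \<rho> i then u v else 0)"
    unfolding fun_sum_apply sum.reindex[OF inj_on_fibre_indicator] o_def
    by (rule sum.cong) (use i v in \<open>auto simp: scaleR_fun_def fibre_indicator_def\<close>)
  then show "u v = 0"
    using i sum0 by (simp add: zero_fun_def split: if_splits)
qed auto

text \<open>The indicators of the nonempty fibres have disjoint supports and form a basis.\<close>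

lemma dim_fibre_constant: "dim (fibre_constant n \<rho>) = card (\<rho> ` {..<n})"
  using dim_span_eq_card_independent[OF independent_fibre_indicator, of n \<rho>]
  by (simp add: span_fibre_indicator card_image inj_on_fibre_indicator)

lemma topspace_Euclidean_space_fibre: "topspace (Euclidean_space n) = fibre_constant n (\<lambda>i. i)"
  by (auto simp: fibre_constant_def)

lemma subspace_topspace_Euclidean_space: "subspace (topspace (Euclidean_space n))"
  unfolding topspace_Euclidean_space_fibre by (rule subspace_fibre_constant)

lemma topspace_Euclidean_space_span:
  obtains S where "finite S" "topspace (Euclidean_space n) = span S"
  by (metis span_fibre_indicator topspace_Euclidean_space_fibre finite_imageI finite_lessThan)

text \<open>In the infinite-dimensional space of all functions \<open>dim\<close> can collapse to
  the \<open>card\<close> of an infinite set, which is 0. Inside \<open>\<real>\<^sup>n\<close> the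
  larger space has a finite basis, and monotonicity holds.\<close>

lemma dim_mono_Euclidean_space:
  assumes "U \<subseteq> W" "W \<subseteq> topspace (Euclidean_space n)"
  shows "dim U \<le> dim W"
proof -
  obtain S where S: "finite S" "topspace (Euclidean_space n) = span S"
    by (rule topspace_Euclidean_space_span)
  obtain B where B: "B \<subseteq> W" "independent B" "W \<subseteq> span B" "card B = dim W"
    by (rule basis_exists)
  have "finite B" using independent_span_bound[OF S(1) B(2)] B(1) assms S(2) by auto
  then show ?thesis using dim_le_card[of U B] assms B by auto
qed

text \<open>A basis of the kernel together with \<open>v\<close> is a basis of \<open>U\<close>:
  subtracting \<open>L x / L v\<close> times \<open>v\<close> from \<open>x\<close> lands in the
  kernel.\<close>

lemma dim_kernel_Suc:
  assumes U: "subspace U" "U \<subseteq> topspace (Euclidean_space n)"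
    and L: "linear (L :: (nat \<Rightarrow> real) \<Rightarrow> real)" and v: "v \<in> U" "L v \<noteq> 0"
  shows "dim U = Suc (dim {x \<in> U. L x = 0})"
proof -
  let ?K = "{x \<in> U. L x = 0}"
  have K: "subspace ?K"
    using U(1) L by (auto simp: subspace_def linear_add linear_scale linear_0)
  obtain S where S: "finite S" "topspace (Euclidean_space n) = span S"
    by (rule topspace_Euclidean_space_span)
  obtain B where B: "B \<subseteq> ?K" "independent B" "?K \<subseteq> span B" "card B = dim ?K"
    by (rule basis_exists)
  have fin: "finite B" using independent_span_bound[OF S(1) B(2)] B(1) U(2) S(2) by auto
  have spanB: "span B = ?K" using B K by (simp add: span_minimal subset_antisym)
  have vB: "v \<notin> span B" using v spanB by auto
  show ?thesis
  proof (rule dim_unique)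
    show "insert v B \<subseteq> U" using v B(1) by auto
    show "independent (insert v B)" using vB B(2) by (rule independent_insertI)
    have "v \<notin> B" using vB span_base by auto
    then show "card (insert v B) = Suc (dim ?K)" using fin B(4) by simp
    show "U \<subseteq> span (insert v B)"
    proof
      fix x assume x: "x \<in> U"
      have "x - (L x / L v) *\<^sub>R v \<in> ?K"
        using x v U(1) L by (simp add: subspace_diff subspace_scale linear_diff linear_scale)
      then have "x - (L x / L v) *\<^sub>R v \<in> span B" using spanB by simp
      then show "x \<in> span (insert v B)" unfolding span_insert by blast
    qed
  qed
qed

text \<open>The differences of points of \<open>V\<close> form a subspace, and those of the section
  are the kernel of \<open>L\<close> in it. The point \<open>x\<close> makes the section nonempty,
  \<open>y\<close> makes it proper.\<close>

lemma affine_dim_hyperplane_section: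
  assumes V: "affine V" "V \<subseteq> topspace (Euclidean_space n)"
    and L: "linear (L :: (nat \<Rightarrow> real) \<Rightarrow> real)"
    and x: "x \<in> V" "L x = c" and y: "y \<in> V" "L y \<noteq> c"
  shows "affine_dim V = Suc (affine_dim (V \<inter> {x. L x = c}))"
proof -
  let ?D = "\<lambda>F. {x - y | x y. x \<in> F \<and> y \<in> F} :: (nat \<Rightarrow> real) set"
  \<comment> \<open>An affine combination with coefficients 1, 1, -1; it rebases an arbitrary
    difference at \<open>x\<close>.\<close>
  have add: "x + (u - w) \<in> V" if "u \<in> V" "w \<in> V" for u w
    using mem_affine_3[OF V(1) x(1) that, of 1 1 "-1"] by (simp add: algebra_simps)
  have D: "?D V = (\<lambda>z. z - x) ` V"
  proof (intro subset_antisym subsetI)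
    fix z assume "z \<in> ?D V"
    then obtain u w where uw: "u \<in> V" "w \<in> V" "z = u - w" by auto
    then show "z \<in> (\<lambda>z. z - x) ` V"
      by (intro image_eqI[of _ _ "x + (u - w)"]) (use add in auto)
  qed (use x in auto)
  have sub: "subspace (?D V)" unfolding D by (rule affine_diffs_subspace_subtract[OF V(1) x(1)])
  have top: "?D V \<subseteq> topspace (Euclidean_space n)"
    using V(2) subspace_topspace_Euclidean_space[of n] by (auto intro: subspace_diff)
  have "?D (V \<inter> {x. L x = c}) = {z \<in> ?D V. L z = 0}"
  proof (intro subset_antisym subsetI)
    fix z assume "z \<in> {z \<in> ?D V. L z = 0}"
    then obtain u w where uw: "u \<in> V" "w \<in> V" "z = u - w" "L z = 0" by auto
    then have "x + (u - w) \<in> V \<inter> {x. L x = c}" using add x L by (simp add: linear_add)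
    moreover have "z = (x + (u - w)) - x" using uw by simp
    ultimately show "z \<in> ?D (V \<inter> {x. L x = c})" using x by blast
  qed (use L in \<open>auto simp: linear_diff\<close>)
  moreover have "dim (?D V) = Suc (dim {z \<in> ?D V. L z = 0})"
    by (rule dim_kernel_Suc[OF sub top L, of "y - x"]) (use x y L in \<open>auto simp: linear_diff\<close>)
  ultimately show ?thesis by (simp add: affine_dim_def)
qed

section \<open>Chambers of an affine arrangement\<close>

definition positive_set :: "('e \<Rightarrow> 'v \<Rightarrow> real) \<Rightarrow> ('e \<Rightarrow> real) \<Rightarrow> 'e set \<Rightarrow> 'v \<Rightarrow> 'e set" where
  "positive_set L c I x = {e \<in> I. c e < L e x}"

text \<open>A chamber is recorded by its sign pattern, so that counting is finite combinatorics.
  Both \<open>I\<close> and \<open>V\<close> may vary, as deletion and restriction require; on a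
  restricted \<open>V\<close> different indices may cut out the same set.\<close>

definition chambers :: "('e \<Rightarrow> 'v \<Rightarrow> real) \<Rightarrow> ('e \<Rightarrow> real) \<Rightarrow> 'e set \<Rightarrow> 'v set \<Rightarrow> 'e set set" where
  "chambers L c I V = positive_set L c I ` {x \<in> V. \<forall>e\<in>I. L e x \<noteq> c e}"

lemma finite_chambers: "finite I \<Longrightarrow> finite (chambers L c I V)"
  by (rule finite_subset[of _ "Pow I"]) (auto simp: chambers_def positive_set_def)

lemma linear_on_line:
  fixes L :: "'v::real_vector \<Rightarrow> real"
  assumes "linear L"
  shows "L (x + s *\<^sub>R (y - x)) = L x + s * (L y - L x)"
  using assms by (simp add: linear_add linear_scale linear_diff)

lemma segment_same_side:
  fixes L :: "'v::real_vector \<Rightarrow> real"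
  assumes "linear L" and s: "0 \<le> s" "s \<le> 1"
    and uw: "c < L u \<longleftrightarrow> c < L w" "L u \<noteq> c" "L w \<noteq> c"
  shows "L (u + s *\<^sub>R (w - u)) \<noteq> c \<and> (c < L (u + s *\<^sub>R (w - u)) \<longleftrightarrow> c < L u)"
proof -
  have L: "L (u + s *\<^sub>R (w - u)) = (1 - s) * L u + s * L w"
    unfolding linear_on_line[OF assms(1)] by (simp add: algebra_simps)
  show ?thesis
  proof (cases "c < L u")
    case True
    \<comment> \<open>\<open>convex_bound_lt\<close> yields upper bounds, hence the change of
      sign.\<close>
    then have "(1 - s) * (- L u) + s * (- L w) < - c"
      using s uw by (intro convex_bound_lt) auto
    then show ?thesis using True unfolding L by auto
  next
    case False
    then have "(1 - s) * L u + s * L w < c"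
      using s uw by (intro convex_bound_lt) auto
    then show ?thesis using False unfolding L by auto
  qed
qed

text \<open>Finitely many strict inequalities at \<open>x\<close> persist nearby. Both directions of
  the line are recorded in order to reach the two sides of a further hyperplane through
  \<open>x\<close>.\<close>

lemma chamber_perturb:
  fixes L :: "'e \<Rightarrow> 'v::real_vector \<Rightarrow> real"
  assumes "finite I" and lin: "\<And>e. e \<in> I \<Longrightarrow> linear (L e)" and x: "\<forall>e\<in>I. L e x \<noteq> c e"
  obtains s where "s > 0" "\<forall>e\<in>I. L e (x + s *\<^sub>R (y - x)) \<noteq> c e"
    "\<forall>e\<in>I. L e (x + (- s) *\<^sub>R (y - x)) \<noteq> c e"
    "positive_set L c I (x + s *\<^sub>R (y - x)) = positive_set L c I x"
    "positive_set L c I (x + (- s) *\<^sub>R (y - x)) = positive_set L c I x"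
proof -
  define same where "same e s \<longleftrightarrow> L e (x + s *\<^sub>R (y - x)) \<noteq> c e
      \<and> (c e < L e (x + s *\<^sub>R (y - x)) \<longleftrightarrow> c e < L e x)" for e s
  have "\<forall>\<^sub>F s in nhds 0. same e s" if e: "e \<in> I" for e
  proof -
    have "((\<lambda>s. L e x + s * (L e y - L e x)) \<longlongrightarrow> L e x + 0 * (L e y - L e x)) (nhds 0)"
      by (intro tendsto_intros filterlim_ident)
    then have lim: "((\<lambda>s. L e (x + s *\<^sub>R (y - x))) \<longlongrightarrow> L e x) (nhds 0)"
      by (simp add: linear_on_line[OF lin[OF e]])
    show ?thesis
    proof (cases "L e x < c e")
      case True
      show ?thesis
        using order_tendstoD(2)[OF lim True]
        by eventually_elim (use True in \<open>auto simp: same_def\<close>)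
    next
      case False
      then have "c e < L e x" using x e by force
      show ?thesis
        using order_tendstoD(1)[OF lim \<open>c e < L e x\<close>]
        by eventually_elim (use \<open>c e < L e x\<close> in \<open>auto simp: same_def\<close>)
    qed
  qed
  then have "\<forall>\<^sub>F s in nhds 0. \<forall>e\<in>I. same e s"
    using \<open>finite I\<close> by (simp add: eventually_ball_finite)
  then obtain d where d: "d > 0" "\<And>s. \<bar>s\<bar> < d \<Longrightarrow> \<forall>e\<in>I. same e s"
    by (auto simp: eventually_nhds_metric dist_real_def)
  have "\<forall>e\<in>I. same e (d / 2)" "\<forall>e\<in>I. same e (- (d / 2))" using d by auto
  then show ?thesis
    by (intro that[of "d / 2"]) (use d(1) in \<open>auto simp: same_def positive_set_def\<close>)
qed

text \<open>Let \<open>M\<close> and \<open>P\<close> be the chambers of \<open>I\<close> that meet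
  the negative and the positive side of the new hyperplane. The enlarged arrangement has
  \<open>card M + card P\<close> chambers. All old chambers make up \<open>M \<union> P\<close>, and
  \<open>M \<inter> P\<close> consists of those cut by the hyperplane, which are the chambers of the
  restriction.\<close>

lemma card_chambers_insert:
  fixes L :: "'e \<Rightarrow> 'v::real_vector \<Rightarrow> real"
  assumes fin: "finite I" and e: "e \<notin> I" and V: "affine V"
    and lin: "\<And>e'. e' \<in> insert e I \<Longrightarrow> linear (L e')"
    and y: "y \<in> V" "L e y \<noteq> c e"
  shows "card (chambers L c (insert e I) V) =
    card (chambers L c I V) + card (chambers L c I (V \<inter> {x. L e x = c e}))"
proof -
  define X where "X = {x \<in> V. \<forall>e'\<in>I. L e' x \<noteq> c e'}"
  define M where "M = positive_set L c I ` {x \<in> X. L e x < c e}"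
  define P where "P = positive_set L c I ` {x \<in> X. c e < L e x}"
  have line: "x + s *\<^sub>R (z - x) \<in> V" if "x \<in> V" "z \<in> V" for x z s
    using mem_affine[OF V that, of "1 - s" s] by (simp add: algebra_simps)
  have sub: "M \<subseteq> Pow I" "P \<subseteq> Pow I" by (auto simp: M_def P_def positive_set_def)
  then have finMP: "finite M" "finite P" using fin by (auto intro: finite_subset)
  have "{x \<in> V. \<forall>e'\<in>insert e I. L e' x \<noteq> c e'}
      = {x \<in> X. L e x < c e} \<union> {x \<in> X. c e < L e x}"
    by (auto simp: X_def)
  moreover have "positive_set L c (insert e I) ` {x \<in> X. L e x < c e} = M"
    unfolding M_def by (rule image_cong) (auto simp: positive_set_def)
  moreover have "positive_set L c (insert e I) ` {x \<in> X. c e < L e x} = insert e ` P"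
    unfolding P_def image_image by (rule image_cong) (auto simp: positive_set_def)
  ultimately have ins: "chambers L c (insert e I) V = M \<union> insert e ` P"
    by (simp add: chambers_def image_Un)
  have "M \<inter> insert e ` P = {}" using sub e by auto
  moreover have "inj_on (insert e) P"
    using sub(2) e by (intro inj_onI) (metis insert_ident PowD subsetD)
  ultimately have card: "card (chambers L c (insert e I) V) = card M + card P"
    unfolding ins by (simp add: card_Un_disjoint finMP card_image)
  \<comment> \<open>Moving a point of the hyperplane slightly towards and away from \<open>y\<close>
    reaches both sides without changing any sign of \<open>I\<close>.\<close>
  have both: "positive_set L c I x \<in> M \<inter> P" if x: "x \<in> X" "L e x = c e" for x
  proof -
    have xI: "\<forall>e'\<in>I. L e' x \<noteq> c e'" and xV: "x \<in> V" using x by (auto simp: X_def)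
    obtain s where s: "s > 0" "\<forall>e\<in>I. L e (x + s *\<^sub>R (y - x)) \<noteq> c e"
      "\<forall>e\<in>I. L e (x + (- s) *\<^sub>R (y - x)) \<noteq> c e"
      "positive_set L c I (x + s *\<^sub>R (y - x)) = positive_set L c I x"
      "positive_set L c I (x + (- s) *\<^sub>R (y - x)) = positive_set L c I x"
      by (rule chamber_perturb[OF fin lin xI]) auto
    have in_X: "x + s *\<^sub>R (y - x) \<in> X" "x + (- s) *\<^sub>R (y - x) \<in> X"
      unfolding X_def using line[OF xV y(1)] s(2,3) by blast+
    have L: "L e (x + s *\<^sub>R (y - x)) = c e + s * (L e y - c e)"
      "L e (x + (- s) *\<^sub>R (y - x)) = c e + (- s) * (L e y - c e)"
      by (simp_all only: linear_on_line[OF lin[OF insertI1]] x(2))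
    show ?thesis
    proof (cases "c e < L e y")
      case True
      then have "0 < s * (L e y - c e)" using s(1) by simp
      then have "x + s *\<^sub>R (y - x) \<in> {x \<in> X. c e < L e x}"
        "x + (- s) *\<^sub>R (y - x) \<in> {x \<in> X. L e x < c e}"
        using in_X by (simp_all only: L mem_Collect_eq) auto
      from imageI[OF this(1), of "positive_set L c I"] imageI[OF this(2), of "positive_set L c I"]
      show ?thesis unfolding M_def P_def s(4,5) by blast
    next
      case False
      then have "s * (L e y - c e) < 0" using s(1) y(2) by (simp add: mult_pos_neg)
      then have "x + (- s) *\<^sub>R (y - x) \<in> {x \<in> X. c e < L e x}"
        "x + s *\<^sub>R (y - x) \<in> {x \<in> X. L e x < c e}"
        using in_X by (simp_all only: L mem_Collect_eq) auto
      from imageI[OF this(1), of "positive_set L c I"] imageI[OF this(2), of "positive_set L c I"]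
      show ?thesis unfolding M_def P_def s(4,5) by blast
    qed
  qed
  have un: "M \<union> P = chambers L c I V"
  proof
    show "M \<union> P \<subseteq> chambers L c I V" by (auto simp: M_def P_def X_def chambers_def)
    show "chambers L c I V \<subseteq> M \<union> P"
    proof
      fix T assume "T \<in> chambers L c I V"
      then obtain x where x: "x \<in> X" "T = positive_set L c I x"
        by (auto simp: chambers_def X_def)
      consider "L e x < c e" | "L e x = c e" | "c e < L e x" by linarith
      then show "T \<in> M \<union> P"
        by cases (use x both in \<open>auto simp: M_def P_def\<close>)
    qed
  qed
  have int: "M \<inter> P = chambers L c I (V \<inter> {x. L e x = c e})"
  proof
    show "chambers L c I (V \<inter> {x. L e x = c e}) \<subseteq> M \<inter> P"
      using both by (auto simp: chambers_def X_def)
    show "M \<inter> P \<subseteq> chambers L c I (V \<inter> {x. L e x = c e})"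
    proof
      fix T assume "T \<in> M \<inter> P"
      then obtain u w where u: "u \<in> X" "L e u < c e" "T = positive_set L c I u"
        and w: "w \<in> X" "c e < L e w" "T = positive_set L c I w"
        by (auto simp: M_def P_def)
      \<comment> \<open>The parameter at which the segment from \<open>u\<close> to \<open>w\<close>
        crosses the new hyperplane.\<close>
      define s where "s = (c e - L e u) / (L e w - L e u)"
      define z where "z = u + s *\<^sub>R (w - u)"
      have s: "0 < s" "s < 1" using u(2) w(2) by (auto simp: s_def field_simps)
      have "L e z = c e"
        unfolding z_def linear_on_line[OF lin[OF insertI1]] using u(2) w(2) by (simp add: s_def)
      moreover have "z \<in> V" unfolding z_def using u w by (intro line) (auto simp: X_def)
      moreover have side: "L e' z \<noteq> c e' \<and> (c e' < L e' z \<longleftrightarrow> c e' < L e' u)" if e': "e' \<in> I" for e'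
      proof -
        have "c e' < L e' u \<longleftrightarrow> c e' < L e' w" "L e' u \<noteq> c e'" "L e' w \<noteq> c e'"
          using u w e' by (auto simp: positive_set_def X_def)
        then show ?thesis
          unfolding z_def using segment_same_side[of "L e'" s "c e'" u w] lin[of e'] e' s by simp
      qed
      moreover have "T = positive_set L c I z"
        using side u(3) by (auto simp: positive_set_def)
      ultimately show "T \<in> chambers L c I (V \<inter> {x. L e x = c e})"
        by (auto simp: chambers_def)
    qed
  qed
  show ?thesis
    unfolding card un[symmetric] int[symmetric] by (rule card_Un_Int[OF finMP])
qed

lemma affine_level_set:
  assumes "affine V" "linear (L :: 'v::real_vector \<Rightarrow> real)"
  shows "affine (V \<inter> {x. L x = c})"
  using assms by (auto simp: affine_def linear_add linear_scale simp flip: distrib_right)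

text \<open>The value 0 on the empty set encodes the restriction to central subarrangements, so that
  sums may run over a full power set.\<close>

definition signed_flat :: "(nat \<Rightarrow> real) set \<Rightarrow> real" where
  "signed_flat F = (if F = {} then 0 else (-1) ^ affine_dim F)"

text \<open>Zaslavsky's count of chambers by deletion and restriction: adding a hyperplane \<open>H\<close> to an
  arrangement on \<open>V\<close> adds one chamber for each chamber of the arrangement induced on \<open>V \<inter> H\<close>.\<close>

lemma zaslavsky:
  fixes L :: "'e \<Rightarrow> (nat \<Rightarrow> real) \<Rightarrow> real"
  assumes "finite I" "affine V" "V \<subseteq> topspace (Euclidean_space n)"
    and "\<And>e. e \<in> I \<Longrightarrow> linear (L e)"
  shows "signed_flat V * real (card (chambers L c I V)) =
    (\<Sum>B\<in>Pow I. (-1) ^ card B * signed_flat (V \<inter> {x. \<forall>e\<in>B. L e x = c e}))"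
  using assms
proof (induction I arbitrary: V rule: finite_induct)
  case empty
  have "chambers L c {} V = (if V = {} then {} else {{}})"
    by (auto simp: chambers_def positive_set_def)
  then show ?case by (simp add: signed_flat_def)
next
  case (insert e I)
  let ?S = "\<lambda>I V. \<Sum>B\<in>Pow I. (-1) ^ card B * signed_flat (V \<inter> {x. \<forall>e\<in>B. L e x = c e})"
  let ?H = "V \<inter> {x. L e x = c e}"
  have lin: "linear (L e)" using insert.prems by simp
  have IH: "signed_flat W * real (card (chambers L c I W)) = ?S I W"
    if "affine W" "W \<subseteq> V" for W
    using insert.IH[of W] that insert.prems by auto
  have "?S (insert e I) V = ?S I V + (\<Sum>B\<in>insert e ` Pow I.
      (-1) ^ card B * signed_flat (V \<inter> {x. \<forall>e\<in>B. L e x = c e}))"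
    unfolding Pow_insert using insert.hyps by (intro sum.union_disjoint) auto
  also have "(\<Sum>B\<in>insert e ` Pow I. (-1) ^ card B * signed_flat (V \<inter> {x. \<forall>e\<in>B. L e x = c e}))
      = (\<Sum>B\<in>Pow I. (-1) ^ card (insert e B) * signed_flat (V \<inter> {x. \<forall>e\<in>insert e B. L e x = c e}))"
    using insert.hyps by (subst sum.reindex) (auto intro!: inj_onI simp: o_def)
  also have "\<dots> = (\<Sum>B\<in>Pow I. - ((-1) ^ card B * signed_flat (?H \<inter> {x. \<forall>e\<in>B. L e x = c e})))"
  proof (rule sum.cong)
    fix B assume B: "B \<in> Pow I"
    then have "card (insert e B) = Suc (card B)"
      using insert.hyps by (auto intro: card_insert_disjoint finite_subset)
    moreover have "V \<inter> {x. \<forall>e\<in>insert e B. L e x = c e} = ?H \<inter> {x. \<forall>e\<in>B. L e x = c e}" by auto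
    ultimately show "(-1) ^ card (insert e B) * signed_flat (V \<inter> {x. \<forall>e\<in>insert e B. L e x = c e})
        = - ((-1) ^ card B * signed_flat (?H \<inter> {x. \<forall>e\<in>B. L e x = c e}))"
      by simp
  qed simp
  also have "\<dots> = - ?S I ?H" by (rule sum_negf)
  finally have rec: "?S (insert e I) V = ?S I V - ?S I ?H" by simp
  show ?case
  \<comment> \<open>If the new hyperplane contains \<open>V\<close>, the two sums cancel and no
    point of \<open>V\<close> is generic.\<close>
  proof (cases "V \<subseteq> {x. L e x = c e}")
    case True
    then have "?H = V" by auto
    moreover have "chambers L c (insert e I) V = {}" using True by (auto simp: chambers_def)
    ultimately show ?thesis using rec by simp
  next
    case False
    then obtain y where y: "y \<in> V" "L e y \<noteq> c e" by auto
    have card: "real (card (chambers L c (insert e I) V)) =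
        real (card (chambers L c I V)) + real (card (chambers L c I ?H))"
      using card_chambers_insert[where L = L and c = c, OF insert.hyps
          insert.prems(1) insert.prems(3) y]
      by simp
    have "?S (insert e I) V = signed_flat V * real (card (chambers L c I V))
        - signed_flat ?H * real (card (chambers L c I ?H))"
      unfolding rec using IH[of V] IH[of ?H] insert.prems(1) affine_level_set[OF _ lin] by simp
    \<comment> \<open>A nonempty restriction has dimension one less; the resulting sign turns the
      difference of the two sums into a sum of chamber counts.\<close>
    also have "signed_flat ?H * real (card (chambers L c I ?H))
        = - signed_flat V * real (card (chambers L c I ?H))"
    proof (cases "?H = {}")
      case True
      then show ?thesis by (simp add: chambers_def)
    next
      case False
      then obtain x where "x \<in> V" "L e x = c e" by auto
      then have "affine_dim V = Suc (affine_dim ?H)"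
        using affine_dim_hyperplane_section[OF insert.prems(1,2) lin _ _ y] by blast
      then show ?thesis using False y by (auto simp: signed_flat_def)
    qed
    finally show ?thesis unfolding card by (simp add: algebra_simps)
  qed
qed

section \<open>Chambers as connected components of the complement\<close>

definition chamber_cell ::
    "('e \<Rightarrow> 'v \<Rightarrow> real) \<Rightarrow> ('e \<Rightarrow> real) \<Rightarrow> 'e set \<Rightarrow> 'v set \<Rightarrow> 'e set \<Rightarrow> 'v set" where
  "chamber_cell L c I V T = {x \<in> V. (\<forall>e\<in>I. L e x \<noteq> c e) \<and> positive_set L c I x = T}"

lemma inj_on_chamber_cell: "inj_on (chamber_cell L c I V) (chambers L c I V)"
proof (rule inj_onI)
  fix S T
  assume "S \<in> chambers L c I V" and eq: "chamber_cell L c I V S = chamber_cell L c I V T"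
  then obtain x where "x \<in> chamber_cell L c I V S"
    by (auto simp: chambers_def chamber_cell_def)
  moreover from this have "x \<in> chamber_cell L c I V T" using eq by simp
  ultimately show "S = T" by (auto simp: chamber_cell_def)
qed

lemma continuous_map_segment:
  assumes "x \<in> topspace (Euclidean_space n)" "y \<in> topspace (Euclidean_space n)"
  shows "continuous_map euclideanreal (Euclidean_space n) (\<lambda>s. x + s *\<^sub>R (y - x))"
  unfolding Euclidean_space_def continuous_map_in_subtopology
proof
  show "continuous_map euclideanreal (powertop_real UNIV) (\<lambda>s. x + s *\<^sub>R (y - x))"
    by (auto simp: continuous_map_componentwise_UNIV scaleR_fun_def intro!: continuous_intros)
  show "(\<lambda>s. x + s *\<^sub>R (y - x)) \<in> topspace euclideanreal \<rightarrow> {x. \<forall>i\<ge>n. x i = 0}"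
    using assms by (auto simp: topspace_Euclidean_space scaleR_fun_def)
qed

text \<open>Two points with the same signs are joined by a segment that avoids all hyperplanes.
  Conversely, each form maps a connected subset of the complement to an interval missing
  \<open>c e\<close>, so signs are constant on components.\<close>

lemma regions_eq_chamber_cells:
  assumes lin: "\<And>e. e \<in> I \<Longrightarrow> linear (L e)"
    and cont: "\<And>e. e \<in> I \<Longrightarrow> continuous_map (Euclidean_space n) euclideanreal (L e)"
  shows "regions n ((\<lambda>e. {x \<in> topspace (Euclidean_space n). L e x = c e}) ` I) =
    chamber_cell L c I (topspace (Euclidean_space n)) ` chambers L c I (topspace (Euclidean_space n))"
proof -
  let ?E = "topspace (Euclidean_space n)"
  define Z where "Z = (\<Union>e\<in>I. {x \<in> ?E. L e x = c e})"
  define G where "G = {x \<in> ?E. \<forall>e\<in>I. L e x \<noteq> c e}"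
  define X where "X = subtopology (Euclidean_space n) (- Z)"
  have top: "topspace X = G" by (auto simp: X_def Z_def G_def)
  have comp: "connected_component_of_set X x
      = chamber_cell L c I ?E (positive_set L c I x)" if x: "x \<in> G" for x
  proof (intro subset_antisym subsetI)
    fix y assume "y \<in> chamber_cell L c I ?E (positive_set L c I x)"
    then have y: "y \<in> G" "positive_set L c I y = positive_set L c I x"
      by (auto simp: chamber_cell_def G_def)
    let ?g = "\<lambda>s. x + s *\<^sub>R (y - x)"
    have cm: "continuous_map euclideanreal (Euclidean_space n) ?g"
      using x y by (intro continuous_map_segment) (auto simp: G_def)
    have "connectedin (Euclidean_space n) (?g ` {0..1})"
      by (rule connectedin_continuous_map_image[OF cm]) simp
    moreover have "?g s \<notin> Z" if s: "s \<in> {0..1}" for s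
    proof -
      have "L e (?g s) \<noteq> c e" if e: "e \<in> I" for e
      proof -
        have "c e < L e x \<longleftrightarrow> c e < L e y" "L e x \<noteq> c e" "L e y \<noteq> c e"
          using e x y by (auto simp: G_def positive_set_def)
        then show ?thesis using segment_same_side[OF lin[OF e], of s "c e" x y] s by auto
      qed
      then show ?thesis by (auto simp: Z_def)
    qed
    ultimately have "connectedin X (?g ` {0..1})"
      unfolding X_def connectedin_subtopology by blast
    moreover have "?g 0 = x" "?g 1 = y" by auto
    then have "x \<in> ?g ` {0..1}" "y \<in> ?g ` {0..1}"
      by (metis atLeastAtMost_iff image_eqI order_refl zero_le_one)+
    ultimately show "y \<in> connected_component_of_set X x"
      unfolding connected_component_of_def by blast
  next
    fix y assume "y \<in> connected_component_of_set X x"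
    then obtain C where C: "connectedin X C" "x \<in> C" "y \<in> C"
      unfolding connected_component_of_def by blast
    then have CG: "C \<subseteq> G" using connectedin_subset_topspace top by blast
    have "c e < L e x \<longleftrightarrow> c e < L e y" if e: "e \<in> I" for e
    proof -
      have "continuous_map X euclideanreal (L e)"
        unfolding X_def by (rule continuous_map_from_subtopology[OF cont[OF e]])
      from connectedin_continuous_map_image[OF this C(1)]
      have conn: "connected (L e ` C)" by simp
      have "L e z \<noteq> c e" if "z \<in> C" for z using CG e that by (auto simp: G_def)
      then have not_in: "c e \<notin> L e ` C" by (metis imageE)
      show ?thesis
      proof (rule ccontr)
        assume "\<not> ?thesis"
        then have "L e x \<le> c e \<and> c e \<le> L e y \<or> L e y \<le> c e \<and> c e \<le> L e x" by linarith
        then show False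
          using connectedD_interval[OF conn, of "L e x" "L e y" "c e"]
            connectedD_interval[OF conn, of "L e y" "L e x" "c e"] C(2,3) not_in by blast
      qed
    qed
    then show "y \<in> chamber_cell L c I ?E (positive_set L c I x)"
      using CG C(3) by (auto simp: chamber_cell_def positive_set_def G_def)
  qed
  have "regions n ((\<lambda>e. {x \<in> ?E. L e x = c e}) ` I) = connected_component_of_set X ` G"
    unfolding regions_def connected_components_of_def X_def[unfolded Z_def, symmetric] top ..
  also have "\<dots> = (\<lambda>x. chamber_cell L c I ?E (positive_set L c I x)) ` G"
    using comp by (rule image_cong[OF refl])
  also have "\<dots> = chamber_cell L c I ?E ` chambers L c I ?E"
    by (simp add: chambers_def G_def image_image)
  finally show ?thesis .
qed

section \<open>Functions constant or monotone along edges\<close>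

text \<open>The component of \<open>i\<close> in the underlying undirected graph, set-valued so that
  it can serve as the map \<open>\<rho>\<close> of \<open>fibre_constant\<close>.\<close>

definition edge_class :: "('a \<times> 'a) set \<Rightarrow> 'a \<Rightarrow> 'a set" where
  "edge_class E i = (E \<union> E\<inverse>)\<^sup>* `` {i}"

lemma edge_class_eq_iff: "edge_class E i = edge_class E j \<longleftrightarrow> (i, j) \<in> (E \<union> E\<inverse>)\<^sup>*"
proof -
  have "sym (E \<union> E\<inverse>)" by (auto simp: sym_def)
  then have "equiv UNIV ((E \<union> E\<inverse>)\<^sup>*)"
    by (auto intro!: equivI refl_rtrancl sym_rtrancl trans_rtrancl)
  then show ?thesis unfolding edge_class_def by (rule eq_equiv_class_iff) auto
qed

text \<open>Equality along edges propagates along undirected paths.\<close>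

lemma edge_constant_iff:
  assumes "E \<subseteq> {..<n::nat} \<times> {..<n}"
  shows "(\<forall>(i, j)\<in>E. f i = f j) \<longleftrightarrow>
    (\<forall>i<n. \<forall>j<n. edge_class E i = edge_class E j \<longrightarrow> f i = f j)" (is "?l \<longleftrightarrow> ?r")
proof
  assume l: ?l
  have "f i = f j" if "(i, j) \<in> (E \<union> E\<inverse>)\<^sup>*" for i j
    using that by induction (use l in auto)
  then show ?r by (simp add: edge_class_eq_iff)
next
  assume r: ?r
  show ?l
  proof clarify
    fix i j assume ij: "(i, j) \<in> E"
    then have "edge_class E i = edge_class E j" by (auto simp: edge_class_eq_iff)
    then show "f i = f j" using r ij assms by blast
  qed
qed

text \<open>Such functions factor uniquely through \<open>\<rho>\<close>. The exponent is the
  dimension in \<open>dim_fibre_constant\<close>, which is what links powers of \<open>k\<close> to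
  dimensions of flats.\<close>

lemma card_fibre_constant_functions:
  fixes k :: nat
  shows "card {f \<in> {..<n::nat} \<rightarrow>\<^sub>E {..<k}. \<forall>i<n. \<forall>j<n. \<rho> i = \<rho> j \<longrightarrow> f i = f j} =
    k ^ card (\<rho> ` {..<n})"
proof -
  let ?F = "{f \<in> {..<n} \<rightarrow>\<^sub>E {..<k}. \<forall>i<n. \<forall>j<n. \<rho> i = \<rho> j \<longrightarrow> f i = f j}"
  let ?u = "\<lambda>g. restrict (g \<circ> \<rho>) {..<n}"
  let ?r = "inv_into {..<n} \<rho>"
  have r: "?r b < n" "\<rho> (?r b) = b" if "b \<in> \<rho> ` {..<n}" for b
    using inv_into_into[OF that] f_inv_into_f[OF that] by auto
  have "bij_betw ?u (\<rho> ` {..<n} \<rightarrow>\<^sub>E {..<k}) ?F"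
  proof (rule bij_betw_imageI)
    show "inj_on ?u (\<rho> ` {..<n} \<rightarrow>\<^sub>E {..<k})"
    proof (rule inj_onI)
      fix g h
      assume g: "g \<in> \<rho> ` {..<n} \<rightarrow>\<^sub>E {..<k}" and h: "h \<in> \<rho> ` {..<n} \<rightarrow>\<^sub>E {..<k}"
        and eq: "?u g = ?u h"
      show "g = h"
      proof (rule PiE_ext[OF g h])
        fix b assume "b \<in> \<rho> ` {..<n}"
        then obtain i where "i < n" "b = \<rho> i" by auto
        then show "g b = h b" using fun_cong[OF eq, of i] by simp
      qed
    qed
    show "?u ` (\<rho> ` {..<n} \<rightarrow>\<^sub>E {..<k}) = ?F"
    proof (intro subset_antisym subsetI)
      fix f assume "f \<in> ?u ` (\<rho> ` {..<n} \<rightarrow>\<^sub>E {..<k})"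
      then show "f \<in> ?F" by (auto simp: PiE_iff)
    next
      fix f assume f: "f \<in> ?F"
      let ?g = "restrict (f \<circ> ?r) (\<rho> ` {..<n})"
      have "?g \<in> \<rho> ` {..<n} \<rightarrow>\<^sub>E {..<k}" using f r(1) by (auto simp: PiE_iff)
      moreover have "f = ?u ?g"
      proof (rule extensionalityI[of _ "{..<n}"])
        fix i assume i: "i \<in> {..<n}"
        then have "?r (\<rho> i) < n" "\<rho> (?r (\<rho> i)) = \<rho> i" using r by auto
        moreover have "\<forall>i<n. \<forall>j<n. \<rho> i = \<rho> j \<longrightarrow> f i = f j" using f by blast
        ultimately have "f i = f (?r (\<rho> i))" using i by (metis lessThan_iff)
        then show "f i = ?u ?g i" using i by simp
      qed (use f in \<open>auto simp: PiE_iff\<close>)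
      ultimately show "f \<in> ?u ` (\<rho> ` {..<n} \<rightarrow>\<^sub>E {..<k})" by blast
    qed
  qed
  then show ?thesis by (simp add: bij_betw_same_card[symmetric] card_funcsetE)
qed

section \<open>Weakly increasing functions on a total preorder\<close>

text \<open>The number of predecessors is monotone and separates inequivalent elements; its values
  are then renumbered without gaps.\<close>

lemma total_preorder_rank:
  fixes R :: "('a \<times> 'a) set"
  assumes fin: "finite S" and R: "refl R" "trans R"
    and total: "\<And>i j. i \<in> S \<Longrightarrow> j \<in> S \<Longrightarrow> (i, j) \<in> R \<or> (j, i) \<in> R"
  obtains \<rho> :: "'a \<Rightarrow> nat" and m where "\<rho> ` S = {..<m}"
    "\<And>i j. i \<in> S \<Longrightarrow> j \<in> S \<Longrightarrow> (i, j) \<in> R \<longleftrightarrow> \<rho> i \<le> \<rho> j"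
proof -
  define g where "g i = card {k \<in> S. (k, i) \<in> R}" for i
  have le: "g i \<le> g j" if "(i, j) \<in> R" for i j
    unfolding g_def using fin that transD[OF R(2)] by (intro card_mono) auto
  have less: "g j < g i" if "i \<in> S" "j \<in> S" "(i, j) \<notin> R" for i j
    unfolding g_def
  proof (rule psubset_card_mono)
    have ji: "(j, i) \<in> R" using total that by blast
    have "i \<in> {k \<in> S. (k, i) \<in> R}" "i \<notin> {k \<in> S. (k, j) \<in> R}"
      using that refl_onD[OF R(1)] by auto
    then show "{k \<in> S. (k, j) \<in> R} \<subset> {k \<in> S. (k, i) \<in> R}"
      using transD[OF R(2) _ ji] by blast
  qed (use fin in auto)
  have g: "(i, j) \<in> R \<longleftrightarrow> g i \<le> g j" if "i \<in> S" "j \<in> S" for i j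
    using le less that by (meson leD)
  obtain h where h: "bij_betw h {..<card (g ` S)} (g ` S)" "strict_mono_on {..<card (g ` S)} h"
    using ex_bij_betw_strict_mono_card[of "g ` S"] fin by auto
  define \<rho> where "\<rho> i = inv_into {..<card (g ` S)} h (g i)" for i
  have h\<rho>: "h (\<rho> i) = g i" "\<rho> i \<in> {..<card (g ` S)}" if "i \<in> S" for i
    unfolding \<rho>_def using h(1) that
    by (auto simp: bij_betw_def f_inv_into_f inv_into_into simp del: lessThan_iff)
  show ?thesis
  proof (rule that)
    show "\<rho> ` S = {..<card (g ` S)}"
      using bij_betw_inv_into[OF h(1)] by (simp add: bij_betw_def \<rho>_def image_image)
    show "(i, j) \<in> R \<longleftrightarrow> \<rho> i \<le> \<rho> j" if "i \<in> S" "j \<in> S" for i j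
      using g[OF that] h\<rho>[OF that(1)] h\<rho>[OF that(2)]
        strict_mono_on_leD[OF h(2)] strict_mono_onD[OF h(2), of "\<rho> j" "\<rho> i"]
      by (metis leD not_le)
  qed
qed

text \<open>Stars and bars: such an \<open>f\<close> is a sorted list of \<open>m\<close> values
  below \<open>k\<close>, that is, a multiset of size \<open>m\<close>. With truncated subtraction
  the formula also covers \<open>k = 0\<close>.\<close>

lemma card_rank_mono_functions:
  fixes \<rho> :: "nat \<Rightarrow> nat"
  assumes surj: "\<rho> ` {..<n} = {..<m}"
  shows "card {f \<in> {..<n} \<rightarrow>\<^sub>E {..<k}. \<forall>i<n. \<forall>j<n. \<rho> i \<le> \<rho> j \<longrightarrow> f i \<le> f j} = (k + m - 1) choose m"
proof -
  let ?F = "{f \<in> {..<n} \<rightarrow>\<^sub>E {..<k}. \<forall>i<n. \<forall>j<n. \<rho> i \<le> \<rho> j \<longrightarrow> f i \<le> f j}"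
  let ?S = "{xs. sorted xs \<and> length xs = m \<and> set xs \<subseteq> {..<k}}"
  let ?r = "inv_into {..<n} \<rho>"
  let ?u = "\<lambda>xs. restrict (\<lambda>i. xs ! \<rho> i) {..<n}"
  have r: "?r b < n" "\<rho> (?r b) = b" if "b < m" for b
  proof -
    have "b \<in> \<rho> ` {..<n}" using surj that by auto
    then show "?r b < n" "\<rho> (?r b) = b"
      using inv_into_into[of b \<rho> "{..<n}"] f_inv_into_f[of b \<rho> "{..<n}"] by auto
  qed
  have \<rho>: "\<rho> i < m" if "i < n" for i using surj that by auto
  have bij: "bij_betw ?u ?S ?F"
  proof (rule bij_betw_imageI)
    show "inj_on ?u ?S"
    proof (rule inj_onI)
      fix xs ys assume xs: "xs \<in> ?S" and ys: "ys \<in> ?S" and eq: "?u xs = ?u ys"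
      show "xs = ys"
      proof (rule nth_equalityI)
        fix b assume "b < length xs"
        then have "b < m" using xs by simp
        then show "xs ! b = ys ! b" using fun_cong[OF eq, of "?r b"] r[of b] by simp
      qed (use xs ys in auto)
    qed
    show "?u ` ?S = ?F"
    proof (intro subset_antisym subsetI)
      fix f assume "f \<in> ?u ` ?S"
      then obtain xs where xs: "xs \<in> ?S" "f = ?u xs" by auto
      have "xs ! \<rho> i < k" if "i < n" for i
      proof -
        have "xs ! \<rho> i \<in> set xs" using xs(1) \<rho>[OF that] by simp
        then show ?thesis using xs(1) by auto
      qed
      moreover have "xs ! \<rho> i \<le> xs ! \<rho> j" if "i < n" "j < n" "\<rho> i \<le> \<rho> j" for i j
        using xs(1) \<rho>[OF that(2)] that by (auto intro: sorted_nth_mono)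
      ultimately show "f \<in> ?F" using xs(2) by (auto simp: PiE_iff)
    next
      fix f assume f: "f \<in> ?F"
      let ?xs = "map (f \<circ> ?r) [0..<m]"
      have mono: "f i \<le> f j" if "i < n" "j < n" "\<rho> i \<le> \<rho> j" for i j using f that by blast
      have bound: "f i < k" if "i < n" for i using f that by (auto simp: PiE_iff)
      have "sorted ?xs"
        unfolding sorted_iff_nth_mono by (auto intro!: mono simp: r)
      then have "?xs \<in> ?S" using bound r(1) by auto
      moreover have "f = ?u ?xs"
      proof (rule extensionalityI[of _ "{..<n}"])
        fix i assume "i \<in> {..<n}"
        then have i: "i < n" by simp
        \<comment> \<open>Equal ranks allow monotonicity to be used in both directions.\<close>
        have "f (?r (\<rho> i)) = f i"
          using mono[of i "?r (\<rho> i)"] mono[of "?r (\<rho> i)" i] r[OF \<rho>[OF i]] i by simp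
        then show "f i = ?u ?xs i" using i \<rho>[OF i] by simp
      qed (use f in \<open>auto simp: PiE_iff\<close>)
      ultimately show "f \<in> ?u ` ?S" by blast
    qed
  qed
  have bij_mset: "bij_betw mset ?S (multisets_of_size {..<k} m)"
  proof (rule bij_betw_byWitness[where f' = sorted_list_of_multiset])
    show "\<forall>a\<in>?S. sorted_list_of_multiset (mset a) = a"
      by (auto simp: sorted_sort_id)
    show "mset ` ?S \<subseteq> multisets_of_size {..<k} m"
      by (auto simp: multisets_of_size_def)
    show "sorted_list_of_multiset ` multisets_of_size {..<k} m \<subseteq> ?S"
      by (auto simp: multisets_of_size_def simp flip: size_mset)
  qed auto
  have "card ?F = card (multisets_of_size {..<k} m)"
    using bij_betw_same_card[OF bij] bij_betw_same_card[OF bij_mset] by simp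
  then show ?thesis by (simp add: card_multisets_of_size)
qed

section \<open>Rays in tubes\<close>

text \<open>Expanding \<open>x - y\<close> in the standard basis gives a Lipschitz constant, the sum
  of the absolute values of \<open>\<phi>\<close> on that basis.\<close>

lemma linear_form_bounded:
  assumes "linear (\<phi> :: (nat \<Rightarrow> real) \<Rightarrow> real)"
  obtains C where "C \<ge> 0" "\<And>x y. x \<in> topspace (Euclidean_space n) \<Longrightarrow>
    y \<in> topspace (Euclidean_space n) \<Longrightarrow> \<bar>\<phi> x - \<phi> y\<bar> \<le> C * euclid_dist n x y"
proof (rule that)
  let ?v = "fibre_indicator n (\<lambda>i. i)"
  show "0 \<le> (\<Sum>i<n. \<bar>\<phi> (?v i)\<bar>)" by (simp add: sum_nonneg)
  fix x y
  assume "x \<in> topspace (Euclidean_space n)" "y \<in> topspace (Euclidean_space n)"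
  then have "x - y \<in> fibre_constant n (\<lambda>i. i)"
    using subspace_topspace_Euclidean_space subspace_diff topspace_Euclidean_space_fibre by metis
  then have "x - y = (\<Sum>b\<in>(\<lambda>i. i) ` {..<n}. (x - y) (inv_into {..<n} (\<lambda>i. i) b) *\<^sub>R ?v b)"
    by (rule fibre_constant_eq_sum)
  also have "\<dots> = (\<Sum>b<n. (x b - y b) *\<^sub>R ?v b)"
    by (rule sum.cong) (auto simp: inv_into_f_f[where f = "\<lambda>i. i"])
  finally have xy: "x - y = (\<Sum>b<n. (x b - y b) *\<^sub>R ?v b)" .
  have "\<phi> x - \<phi> y = \<phi> (x - y)" using assms by (simp add: linear_diff)
  also have "\<dots> = (\<Sum>b<n. (x b - y b) * \<phi> (?v b))"
    unfolding xy using assms by (simp add: linear_sum linear_scale)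
  finally have "\<bar>\<phi> x - \<phi> y\<bar> \<le> (\<Sum>b<n. \<bar>x b - y b\<bar> * \<bar>\<phi> (?v b)\<bar>)"
    by (simp add: sum_abs flip: abs_mult)
  also have "\<dots> \<le> (\<Sum>b<n. euclid_dist n x y * \<bar>\<phi> (?v b)\<bar>)"
  proof (rule sum_mono)
    fix b assume "b \<in> {..<n}"
    then have "\<bar>x b - y b\<bar> \<le> euclid_dist n x y"
      unfolding euclid_dist_def using member_le_L2_set[of "{..<n}" b "\<lambda>i. \<bar>x i - y i\<bar>"]
      by (simp add: L2_set_def)
    then show "\<bar>x b - y b\<bar> * \<bar>\<phi> (?v b)\<bar> \<le> euclid_dist n x y * \<bar>\<phi> (?v b)\<bar>"
      by (simp add: mult_right_mono)
  qed
  finally show "\<bar>\<phi> x - \<phi> y\<bar> \<le> (\<Sum>i<n. \<bar>\<phi> (?v i)\<bar>) * euclid_dist n x y"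
    by (simp add: sum_distrib_left mult.commute)
qed

lemma euclid_dist_nonneg: "0 \<le> euclid_dist n x y"
  by (simp add: euclid_dist_def L2_set_nonneg)

text \<open>A linear form vanishing on \<open>W\<close> is bounded on a tube around \<open>W\<close>, hence vanishes at the
  direction of every ray inside the tube.\<close>

lemma ray_direction_in_tube_axis:
  assumes W: "subspace W" "W \<subseteq> topspace (Euclidean_space n)"
    and v: "v \<in> topspace (Euclidean_space n)"
    and ray: "\<And>s. s \<ge> 0 \<Longrightarrow> x + s *\<^sub>R v \<in> topspace (Euclidean_space n)"
      "\<And>s. s \<ge> 0 \<Longrightarrow> (INF w\<in>W. euclid_dist n (x + s *\<^sub>R v) w) \<le> r"
  shows "v \<in> W"
proof (rule ccontr)
  assume "v \<notin> W"
  obtain B where B: "B \<subseteq> W" "independent B" "W \<subseteq> span B" by (rule maximal_independent_subset)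
  have spanB: "span B = W" using B W(1) by (simp add: span_minimal subset_antisym)
  then have "v \<notin> span B" using \<open>v \<notin> W\<close> by simp
  then have ind: "independent (insert v B)" using B(2) by (rule independent_insertI)
  \<comment> \<open>A form that vanishes on \<open>W\<close> and takes the value 1 at
    \<open>v\<close>, defined on the basis \<open>B\<close> of \<open>W\<close> enlarged by
    \<open>v\<close>.\<close>
  obtain \<phi> :: "(nat \<Rightarrow> real) \<Rightarrow> real" where \<phi>: "linear \<phi>"
    "\<forall>x\<in>insert v B. \<phi> x = (if x = v then 1 else 0)"
    using linear_independent_extend[OF ind, of "\<lambda>x. if x = v then 1 else 0"] by blast
  have \<phi>v: "\<phi> v = 1" using \<phi>(2) by simp
  have \<phi>B: "\<phi> b = 0" if "b \<in> B" for b
    using \<phi>(2) that \<open>v \<notin> W\<close> B(1) by auto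
  have \<phi>W: "\<phi> w = 0" if "w \<in> W" for w
    using linear_eq_0_on_span[OF \<phi>(1) \<phi>B] that spanB by blast
  obtain C where C: "C \<ge> 0" "\<And>x y. x \<in> topspace (Euclidean_space n) \<Longrightarrow>
      y \<in> topspace (Euclidean_space n) \<Longrightarrow> \<bar>\<phi> x - \<phi> y\<bar> \<le> C * euclid_dist n x y"
    using linear_form_bounded[OF \<phi>(1), of n] by blast
  have "W \<noteq> {}" using W(1) subspace_0 by blast
  have bound: "\<bar>\<phi> (x + s *\<^sub>R v)\<bar> \<le> C * (r + 1)" if "s \<ge> 0" for s
  proof -
    \<comment> \<open>Enlarging the radius to \<open>r + 1\<close> gives an actual point of
      \<open>W\<close> at that distance, whether or not the infimum is attained.\<close>
    have "(INF w\<in>W. euclid_dist n (x + s *\<^sub>R v) w) < r + 1" using ray(2)[OF that] by simp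
    then obtain w where w: "w \<in> W" "euclid_dist n (x + s *\<^sub>R v) w < r + 1"
      using cInf_lessD[of "(\<lambda>w. euclid_dist n (x + s *\<^sub>R v) w) ` W" "r + 1"] \<open>W \<noteq> {}\<close> by auto
    have "\<bar>\<phi> (x + s *\<^sub>R v)\<bar> \<le> C * euclid_dist n (x + s *\<^sub>R v) w"
      using C(2)[OF ray(1)[OF that], of w] w(1) W(2) \<phi>W[OF w(1)] by auto
    also have "\<dots> \<le> C * (r + 1)" using w(2) C(1) by (intro mult_left_mono) auto
    finally show ?thesis .
  qed
  \<comment> \<open>Large enough for \<open>\<phi> x + s\<close> to exceed the bound
    \<open>C * (r + 1)\<close>.\<close>
  define s where "s = C * (r + 1) + \<bar>\<phi> x\<bar> + 1"
  have "0 \<le> C * (r + 1)" using bound[of 0] by (meson abs_ge_zero order_trans order_refl)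
  then have "s \<ge> 0" by (simp add: s_def)
  have "\<phi> (x + s *\<^sub>R v) = \<phi> x + s" using \<phi>(1) \<phi>v by (simp add: linear_add linear_scale)
  then show False using bound[OF \<open>s \<ge> 0\<close>] by (simp add: s_def)
qed

section \<open>Regions of difference arrangements\<close>

definition diff_triples :: "nat \<Rightarrow> real set \<Rightarrow> (nat \<times> nat \<times> real) set" where
  "diff_triples n A = {(i, j, a). i < j \<and> j < n \<and> a \<in> A}"

definition diff_form :: "nat \<times> nat \<times> real \<Rightarrow> (nat \<Rightarrow> real) \<Rightarrow> real" where
  "diff_form e x = x (fst e) - x (fst (snd e))"

definition diff_const :: "nat \<times> nat \<times> real \<Rightarrow> real" where
  "diff_const e = snd (snd e)"

lemmas diff_defs = diff_triples_def diff_form_def diff_const_def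

abbreviation diff_chambers :: "nat \<Rightarrow> real set \<Rightarrow> (nat \<times> nat \<times> real) set set" where
  "diff_chambers n A \<equiv>
    chambers diff_form diff_const (diff_triples n A) (topspace (Euclidean_space n))"

abbreviation diff_cell ::
    "nat \<Rightarrow> real set \<Rightarrow> (nat \<times> nat \<times> real) set \<Rightarrow> (nat \<Rightarrow> real) set" where
  "diff_cell n A \<equiv>
    chamber_cell diff_form diff_const (diff_triples n A) (topspace (Euclidean_space n))"

lemma finite_diff_triples: "finite A \<Longrightarrow> finite (diff_triples n A)"
  by (rule finite_subset[of _ "{..<n} \<times> {..<n} \<times> A"]) (auto simp: diff_triples_def)

lemma linear_diff_form: "linear (diff_form e)"
  by (rule linearI) (simp_all add: diff_form_def scaleR_fun_def algebra_simps)

lemma continuous_map_diff_form: "continuous_map (Euclidean_space n) euclideanreal (diff_form e)"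
proof -
  have "continuous_map (Euclidean_space n) euclideanreal (\<lambda>x. x i)" for i
    unfolding Euclidean_space_def
    by (intro continuous_map_from_subtopology continuous_map_product_projection) auto
  then show ?thesis
    unfolding diff_form_def by (intro continuous_map_diff) auto
qed

text \<open>An edge \<open>p \<rightarrow> q\<close> records that \<open>x\<^sub>p - x\<^sub>q\<close> is bounded below on the region, so that
  \<open>y\<^sub>p \<ge> y\<^sub>q\<close> for every direction \<open>y\<close> in which the region is unbounded.\<close>

definition forced_edges :: "nat \<Rightarrow> real set \<Rightarrow> (nat \<times> nat \<times> real) set \<Rightarrow> (nat \<times> nat) set" where
  "forced_edges n A T = {(p, q). p < n \<and> q < n \<and>
    (p < q \<and> (p, q, Min A) \<in> T \<or> q < p \<and> (q, p, Max A) \<notin> T)}"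

lemma diff_cell_sign:
  assumes "x \<in> diff_cell n A T" "p < q" "q < n" "a \<in> A"
  shows "(p, q, a) \<in> T \<longleftrightarrow> a < x p - x q" "(p, q, a) \<notin> T \<longleftrightarrow> x p - x q < a"
  using assms by (force simp: chamber_cell_def positive_set_def diff_defs)+

lemma diff_cellI:
  assumes "z \<in> topspace (Euclidean_space n)" "T \<subseteq> diff_triples n A"
    and sign: "\<And>p q a. p < q \<Longrightarrow> q < n \<Longrightarrow> a \<in> A \<Longrightarrow>
      a \<noteq> z p - z q \<and> (a < z p - z q \<longleftrightarrow> (p, q, a) \<in> T)"
  shows "z \<in> diff_cell n A T"
proof -
  have "diff_form e z \<noteq> diff_const e \<and> (diff_const e < diff_form e z \<longleftrightarrow> e \<in> T)"
    if "e \<in> diff_triples n A" for e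
    using that sign[of "fst e" "fst (snd e)" "snd (snd e)"] by (auto simp: diff_defs)
  then show ?thesis using assms(1,2) by (auto simp: chamber_cell_def positive_set_def)
qed

text \<open>For \<open>p < q\<close>, absence of both edges would put \<open>x p - x q\<close> below
  \<open>Min A\<close> and above \<open>Max A\<close> at once.\<close>

lemma forced_edges_semicomplete:
  assumes A: "finite A" "A \<noteq> {}" and T: "T \<in> diff_chambers n A" and pq: "p < n" "q < n"
  shows "(p, q) \<in> (forced_edges n A T)\<^sup>* \<or> (q, p) \<in> (forced_edges n A T)\<^sup>*"
proof -
  obtain x where x: "x \<in> diff_cell n A T"
    using T by (auto simp: chambers_def chamber_cell_def)
  have "(p, q) \<in> forced_edges n A T \<or> (q, p) \<in> forced_edges n A T"
    if "p < q" "p < n" "q < n" for p q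
  proof -
    have "Min A \<in> A" "Max A \<in> A" "Min A \<le> Max A" using A by auto
    then have "(p, q, Min A) \<in> T \<or> (p, q, Max A) \<notin> T"
      using diff_cell_sign[OF x that(1,3), of "Min A"] diff_cell_sign[OF x that(1,3), of "Max A"]
      by linarith
    then show ?thesis using that by (auto simp: forced_edges_def)
  qed
  then show ?thesis using pq by (cases p q rule: linorder_cases) blast+
qed

text \<open>The strong components are linearly ordered; \<open>\<rho>\<close> numbers them from 0 to
  \<open>m - 1\<close>.\<close>

lemma forced_edges_rank:
  assumes "finite A" "A \<noteq> {}" "T \<in> diff_chambers n A"
  obtains \<rho> :: "nat \<Rightarrow> nat" and m where "\<rho> ` {..<n} = {..<m}"
    "\<And>i j. i < n \<Longrightarrow> j < n \<Longrightarrow> (i, j) \<in> (forced_edges n A T)\<^sup>* \<longleftrightarrow> \<rho> i \<le> \<rho> j"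
  using total_preorder_rank[of "{..<n}" "(forced_edges n A T)\<^sup>*"]
    forced_edges_semicomplete[OF assms] refl_rtrancl trans_rtrancl
  by (metis finite_lessThan lessThan_iff)

text \<open>Each edge bounds the difference by \<open>max (- Min A) (Max A)\<close>, and the bounds
  add up along a path.\<close>

lemma forced_edges_bounded_below:
  assumes A: "finite A" "A \<noteq> {}" and "(i, j) \<in> (forced_edges n A T)\<^sup>*"
  shows "\<exists>K. \<forall>x\<in>diff_cell n A T. x j - x i \<le> K"
  using assms(3)
proof induction
  case base
  then show ?case by auto
next
  case (step j k)
  from step.IH obtain K where K: "\<forall>x\<in>diff_cell n A T. x j - x i \<le> K" by blast
  have edge: "x k - x j \<le> max (- Min A) (Max A)" if x: "x \<in> diff_cell n A T" for x
  proof -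
    have jk: "j < n" "k < n" "j < k \<and> (j, k, Min A) \<in> T \<or> k < j \<and> (k, j, Max A) \<notin> T"
      using step.hyps by (auto simp: forced_edges_def)
    then have "Min A < x j - x k \<or> x k - x j < Max A"
      using diff_cell_sign(1)[OF x, of j k "Min A"] diff_cell_sign(2)[OF x, of k j "Max A"]
        Min_in[OF A] Max_in[OF A] by blast
    then show ?thesis by linarith
  qed
  have "x k - x i \<le> K + max (- Min A) (Max A)" if x: "x \<in> diff_cell n A T" for x
    using edge[OF x] K x by force
  then show ?case by blast
qed

text \<open>No hyperplane is crossed along the ray. If \<open>v p < v q\<close> with
  \<open>p < q\<close>, the edge from \<open>p\<close> to \<open>q\<close> is absent, so
  \<open>x p - x q\<close> already lies below \<open>Min A\<close> and only decreases; the case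
  \<open>v q < v p\<close> is symmetric with \<open>Max A\<close>.\<close>

lemma diff_cell_ray:
  assumes A: "finite A" "A \<noteq> {}" and x: "x \<in> diff_cell n A T"
    and v: "v \<in> topspace (Euclidean_space n)" "\<forall>(i, j)\<in>forced_edges n A T. v j \<le> v i"
    and s: "s \<ge> 0"
  shows "x + s *\<^sub>R v \<in> diff_cell n A T"
proof -
  have sign: "a \<noteq> (x + s *\<^sub>R v) p - (x + s *\<^sub>R v) q
      \<and> (a < (x + s *\<^sub>R v) p - (x + s *\<^sub>R v) q \<longleftrightarrow> (p, q, a) \<in> T)"
    if pq: "p < q" "q < n" and a: "a \<in> A" for p q a
  proof -
    have MM: "Min A \<le> a" "a \<le> Max A" using A a by auto
    have eq: "(x + s *\<^sub>R v) p - (x + s *\<^sub>R v) q = x p - x q + s * (v p - v q)"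
      by (simp add: scaleR_fun_def algebra_simps)
    consider "v p = v q" | "v p < v q" | "v q < v p" by linarith
    then show ?thesis
    proof cases
      case 1
      then show ?thesis unfolding eq using diff_cell_sign[OF x pq a] by auto
    next
      case 2
      then have "(p, q) \<notin> forced_edges n A T" using v(2) by force
      then have "x p - x q < Min A"
        using pq diff_cell_sign(2)[OF x pq, of "Min A"] A by (auto simp: forced_edges_def)
      moreover have "s * (v p - v q) \<le> 0" using 2 s by (simp add: mult_nonneg_nonpos)
      ultimately show ?thesis
        unfolding eq using MM diff_cell_sign[OF x pq a] by auto
    next
      case 3
      then have "(q, p) \<notin> forced_edges n A T" using v(2) by force
      then have "Max A < x p - x q"
        using pq diff_cell_sign(1)[OF x pq, of "Max A"] A by (auto simp: forced_edges_def)
      moreover have "0 \<le> s * (v p - v q)" using 3 s by simp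
      ultimately show ?thesis
        unfolding eq using MM diff_cell_sign[OF x pq a] by auto
    qed
  qed
  have "x + s *\<^sub>R v \<in> topspace (Euclidean_space n)"
    using x v(1) subspace_topspace_Euclidean_space[of n]
    by (auto simp: chamber_cell_def intro: subspace_add subspace_scale)
  moreover have "T \<subseteq> diff_triples n A" using x by (auto simp: chamber_cell_def positive_set_def)
  ultimately show ?thesis
    using sign by (intro diff_cellI) blast+
qed

text \<open>Differences within a strong component are bounded in both directions, so the region lies
  in a tube around the \<open>m\<close>-dimensional space \<open>fibre_constant n \<rho>\<close>.
  Conversely, ray directions of the region span that space, so every admissible axis
  \<open>W\<close> contains it.\<close>

lemma level_diff_cell:
  fixes \<rho> :: "nat \<Rightarrow> nat"
  assumes A: "finite A" "A \<noteq> {}" and T: "T \<in> diff_chambers n A"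
    and \<rho>: "\<rho> ` {..<n} = {..<m}"
      "\<And>i j. i < n \<Longrightarrow> j < n \<Longrightarrow> (i, j) \<in> (forced_edges n A T)\<^sup>* \<longleftrightarrow> \<rho> i \<le> \<rho> j"
  shows "level n (diff_cell n A T) = m"
  unfolding level_def
proof (rule Least_equality)
  let ?E = "topspace (Euclidean_space n)"
  let ?R = "diff_cell n A T"
  have dim: "dim (fibre_constant n \<rho>) = m" by (simp add: dim_fibre_constant \<rho>(1))
  have "\<exists>K. \<forall>x\<in>?R. \<rho> i \<le> \<rho> j \<longrightarrow> x j - x i \<le> K" if "i < n" "j < n" for i j
    using forced_edges_bounded_below[OF A, of i j n T] \<rho>(2)[OF that] by blast
  then obtain K where K: "\<And>i j x. i < n \<Longrightarrow> j < n \<Longrightarrow> x \<in> ?R \<Longrightarrow> \<rho> i \<le> \<rho> j \<Longrightarrow> x j - x i \<le> K i j"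
    by metis
  define M where "M = (\<Sum>i<n. \<Sum>j<n. \<bar>K i j\<bar>)"
  have "K i j \<le> M" if "i < n" "j < n" for i j
  proof -
    have "\<bar>K i j\<bar> \<le> (\<Sum>j<n. \<bar>K i j\<bar>)" using that by (intro member_le_sum) auto
    also have "\<dots> \<le> M"
      unfolding M_def using that
      by (intro member_le_sum[of i _ "\<lambda>i. \<Sum>j<n. \<bar>K i j\<bar>"]) (auto simp: sum_nonneg)
    finally show ?thesis by simp
  qed
  then have M: "\<bar>x i - x j\<bar> \<le> M" if "i < n" "j < n" "x \<in> ?R" "\<rho> i = \<rho> j" for x i j
    using K[of i j x] K[of j i x] that by (smt (verit) order_refl)
  have "M \<ge> 0" by (simp add: M_def sum_nonneg)
  \<comment> \<open>The nearby point \<open>w\<close> copies to each vertex the coordinate of a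
    representative of its component. The \<open>+ 1\<close> keeps the radius positive when
    \<open>M\<close> is 0.\<close>
  have tube: "(INF w\<in>fibre_constant n \<rho>. euclid_dist n x w) \<le> real n * M + 1" if x: "x \<in> ?R" for x
  proof -
    let ?r = "inv_into {..<n} \<rho>"
    define w where "w i = (if i < n then x (?r (\<rho> i)) else 0)" for i
    have r: "?r (\<rho> i) < n" "\<rho> (?r (\<rho> i)) = \<rho> i" if "i < n" for i
      using that inv_into_into[of "\<rho> i" \<rho> "{..<n}"] f_inv_into_f[of "\<rho> i" \<rho> "{..<n}"] by auto
    have "w \<in> fibre_constant n \<rho>" by (rule fibre_constantI) (auto simp: w_def)
    moreover have "bdd_below (euclid_dist n x ` fibre_constant n \<rho>)"
      by (rule bdd_belowI[of _ 0]) (auto simp: euclid_dist_nonneg)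
    ultimately have "(INF w\<in>fibre_constant n \<rho>. euclid_dist n x w) \<le> euclid_dist n x w"
      by (simp add: cINF_lower)
    also have "\<dots> \<le> (\<Sum>i<n. \<bar>x i - w i\<bar>)" unfolding euclid_dist_def by (rule L2_set_le_sum_abs)
    also have "\<dots> \<le> (\<Sum>i<n. M)"
      by (rule sum_mono) (auto simp: w_def r intro!: M x)
    finally show ?thesis by simp
  qed
  show "\<exists>W r. subspace W \<and> W \<subseteq> ?E \<and> dim W = m \<and> r > 0
      \<and> ?R \<subseteq> {x \<in> ?E. (INF w\<in>W. euclid_dist n x w) \<le> r}"
    by (rule exI[of _ "fibre_constant n \<rho>"], rule exI[of _ "real n * M + 1"])
      (use subspace_fibre_constant dim tube \<open>M \<ge> 0\<close> in
        \<open>auto simp: fibre_constant_def chamber_cell_def add_nonneg_pos\<close>)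
  fix l
  assume "\<exists>W r. subspace W \<and> W \<subseteq> ?E \<and> dim W = l \<and> r > 0
      \<and> ?R \<subseteq> {x \<in> ?E. (INF w\<in>W. euclid_dist n x w) \<le> r}"
  then obtain W r where W: "subspace W" "W \<subseteq> ?E" "dim W = l"
    and R: "?R \<subseteq> {x \<in> ?E. (INF w\<in>W. euclid_dist n x w) \<le> r}"
    by blast
  obtain x where x: "x \<in> ?R" using T by (auto simp: chambers_def chamber_cell_def)
  \<comment> \<open>Indicators of the initial segments of ranks; they decrease weakly along edges
    and hence are ray directions. Consecutive ones differ by a fibre indicator.\<close>
  define v where "v b = (\<lambda>i. if i < n \<and> \<rho> i < b then 1 else (0::real))" for b
  have "v b \<in> W" for b
  proof (rule ray_direction_in_tube_axis[OF W(1,2)])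
    show v_E: "v b \<in> ?E" by (simp add: v_def topspace_Euclidean_space)
    have "v b j \<le> v b i" if "(i, j) \<in> forced_edges n A T" for i j
    proof -
      have "i < n" "j < n" using that by (auto simp: forced_edges_def)
      then have "\<rho> i \<le> \<rho> j" using \<rho>(2) that by blast
      then show ?thesis using \<open>i < n\<close> by (auto simp: v_def)
    qed
    then have ray: "x + s *\<^sub>R v b \<in> ?R" if "s \<ge> 0" for s
      using diff_cell_ray[OF A x v_E _ that] by blast
    show "x + s *\<^sub>R v b \<in> ?E" "(INF w\<in>W. euclid_dist n (x + s *\<^sub>R v b) w) \<le> r" if "s \<ge> 0" for s
      using ray[OF that] R by auto
  qed
  moreover have "fibre_indicator n \<rho> b = v (Suc b) - v b" for b
    by (auto simp: fibre_indicator_def v_def fun_eq_iff)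
  ultimately have "fibre_indicator n \<rho> b \<in> W" for b
    using subspace_diff[OF W(1)] by simp
  then have "fibre_constant n \<rho> \<subseteq> W"
    unfolding span_fibre_indicator[symmetric] by (intro span_minimal W(1)) auto
  then show "m \<le> l" using dim_mono_Euclidean_space[OF _ W(2)] dim W(3) by metis
qed

text \<open>Monotonicity along edges extends to paths and so becomes monotonicity in the rank, while
  the level is the number of ranks.\<close>

lemma card_mono_functions_eq_level:
  assumes A: "finite A" "A \<noteq> {}" and T: "T \<in> diff_chambers n A"
  shows "level n (diff_cell n A T) \<le> n"
    and "card {f \<in> {..<n} \<rightarrow>\<^sub>E {..<k}. \<forall>(i, j)\<in>forced_edges n A T. f i \<le> f j} =
      (k + level n (diff_cell n A T) - 1) choose level n (diff_cell n A T)"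
proof -
  obtain \<rho> :: "nat \<Rightarrow> nat" and m where \<rho>: "\<rho> ` {..<n} = {..<m}"
    "\<And>i j. i < n \<Longrightarrow> j < n \<Longrightarrow> (i, j) \<in> (forced_edges n A T)\<^sup>* \<longleftrightarrow> \<rho> i \<le> \<rho> j"
    using forced_edges_rank[OF assms] by metis
  have level: "level n (diff_cell n A T) = m" by (rule level_diff_cell[OF assms \<rho>])
  show "level n (diff_cell n A T) \<le> n"
    unfolding level using card_image_le[of "{..<n}" \<rho>] \<rho>(1) by simp
  have "(\<forall>(i, j)\<in>forced_edges n A T. f i \<le> f j)
      \<longleftrightarrow> (\<forall>i<n. \<forall>j<n. \<rho> i \<le> \<rho> j \<longrightarrow> f i \<le> f j)" for f :: "nat \<Rightarrow> nat"
  proof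
    assume l: "\<forall>(i, j)\<in>forced_edges n A T. f i \<le> f j"
    have "f i \<le> f j" if "(i, j) \<in> (forced_edges n A T)\<^sup>*" for i j
      using that by induction (use l in force)+
    then show "\<forall>i<n. \<forall>j<n. \<rho> i \<le> \<rho> j \<longrightarrow> f i \<le> f j" using \<rho>(2) by blast
  next
    assume r: "\<forall>i<n. \<forall>j<n. \<rho> i \<le> \<rho> j \<longrightarrow> f i \<le> f j"
    show "\<forall>(i, j)\<in>forced_edges n A T. f i \<le> f j"
    proof clarify
      fix i j assume ij: "(i, j) \<in> forced_edges n A T"
      then have "i < n" "j < n" by (auto simp: forced_edges_def)
      then show "f i \<le> f j" using r \<rho>(2)[of i j] ij by blast
    qed
  qed
  then show "card {f \<in> {..<n} \<rightarrow>\<^sub>E {..<k}. \<forall>(i, j)\<in>forced_edges n A T. f i \<le> f j} =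
      (k + level n (diff_cell n A T) - 1) choose level n (diff_cell n A T)"
    unfolding level by (simp add: card_rank_mono_functions[OF \<rho>(1)])
qed

section \<open>Evaluation at negative integers\<close>

definition diff_hyperplane :: "nat \<Rightarrow> nat \<times> nat \<times> real \<Rightarrow> (nat \<Rightarrow> real) set" where
  "diff_hyperplane n e = {x \<in> topspace (Euclidean_space n). diff_form e x = diff_const e}"

definition diff_flat :: "nat \<Rightarrow> (nat \<times> nat \<times> real) set \<Rightarrow> (nat \<Rightarrow> real) set" where
  "diff_flat n B = topspace (Euclidean_space n) \<inter> {x. \<forall>e\<in>B. diff_form e x = diff_const e}"

lemma difference_arrangement_eq: "difference_arrangement n A = diff_hyperplane n ` diff_triples n A"
  by (force simp: difference_arrangement_def diff_hyperplane_def diff_defs image_iff)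

text \<open>Lets triples replace hyperplanes without changing \<open>card B\<close> in the
  characteristic polynomial.\<close>

lemma inj_on_diff_hyperplane: "inj_on (diff_hyperplane n) (diff_triples n A)"
proof -
  have sub: "{k, l} \<subseteq> {i, j} \<and> b = a"
    if ij: "i < j" "j < n" and kl: "k < l" "l < n"
      and eq: "diff_hyperplane n (i, j, a) = diff_hyperplane n (k, l, b)" for i j k l a b
  proof -
    have mem: "x k - x l = b" if "\<forall>i\<ge>n. x i = 0" "x i - x j = a" for x
    proof -
      have "x \<in> diff_hyperplane n (i, j, a)"
        using that by (simp add: diff_hyperplane_def diff_defs topspace_Euclidean_space)
      then show ?thesis unfolding eq by (simp add: diff_hyperplane_def diff_defs)
    qed
    define y where "y = (\<lambda>m. if m = i then a else 0)"
    have y: "y k - y l = b" by (rule mem) (use ij in \<open>auto simp: y_def\<close>)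
    have shift: "m \<in> {i, j}" if m: "m \<in> {k, l}" for m
    proof (rule ccontr)
      assume "m \<notin> {i, j}"
      \<comment> \<open>Changing a coordinate outside \<open>{i, j}\<close> stays on the first
        hyperplane but alters the difference defining the second.\<close>
      then have "(y(m := y m + 1)) k - (y(m := y m + 1)) l = b"
        by (intro mem) (use ij kl m in \<open>auto simp: y_def\<close>)
      then show False using y m kl by (auto split: if_splits)
    qed
    then have "{k, l} \<subseteq> {i, j}" by blast
    moreover from this have "k = i" "l = j" using ij kl by auto
    ultimately show ?thesis using y kl by (simp add: y_def)
  qed
  show ?thesis
  proof (rule inj_onI)
    fix e e' assume e: "e \<in> diff_triples n A" "e' \<in> diff_triples n A"
      and eq: "diff_hyperplane n e = diff_hyperplane n e'"
    obtain i j a k l b where [simp]: "e = (i, j, a)" "e' = (k, l, b)"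
      by (cases e, cases e') auto
    have "i < j" "j < n" "k < l" "l < n" using e by (auto simp: diff_triples_def)
    then show "e = e'" using sub[of i j k l a b] eq by auto
  qed
qed

lemma poly_arrangement_poly_diff:
  assumes "finite A"
  shows "poly (arrangement_poly n (difference_arrangement n A)) t =
    (\<Sum>B\<in>Pow (diff_triples n A).
      if diff_flat n B = {} then 0 else (-1) ^ card B * t ^ affine_dim (diff_flat n B))"
proof -
  let ?I = "diff_triples n A"
  let ?H = "diff_hyperplane n"
  let ?g = "\<lambda>C. (-1) ^ card C * t ^ affine_dim (flat n C)"
  have fin: "finite (Pow ?I)" using assms by (simp add: finite_diff_triples)
  have flat: "flat n (?H ` B) = diff_flat n B" for B
    by (auto simp: flat_def diff_flat_def diff_hyperplane_def)
  have "poly (arrangement_poly n (difference_arrangement n A)) t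
      = (\<Sum>C | C \<in> Pow (?H ` ?I) \<and> flat n C \<noteq> {}. ?g C)"
    by (simp add: arrangement_poly_def difference_arrangement_eq poly_sum poly_monom)
  also have "\<dots> = (\<Sum>C\<in>Pow (?H ` ?I). if flat n C \<noteq> {} then ?g C else 0)"
    using assms by (intro sum.inter_filter) (simp add: finite_diff_triples)
  also have "Pow (?H ` ?I) = image ?H ` Pow ?I" by (rule image_Pow_surj[symmetric]) simp
  also have "(\<Sum>C\<in>image ?H ` Pow ?I. if flat n C \<noteq> {} then ?g C else 0)
      = (\<Sum>B\<in>Pow ?I. if flat n (?H ` B) \<noteq> {} then ?g (?H ` B) else 0)"
    by (rule sum.reindex_cong[OF inj_on_image_Pow[OF inj_on_diff_hyperplane]]) auto
  also have "\<dots> = (\<Sum>B\<in>Pow ?I.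
      if diff_flat n B = {} then 0 else (-1) ^ card B * t ^ affine_dim (diff_flat n B))"
  proof (rule sum.cong)
    fix B assume "B \<in> Pow ?I"
    then have "card (?H ` B) = card B"
      by (intro card_image inj_on_subset[OF inj_on_diff_hyperplane]) auto
    then show "(if flat n (?H ` B) \<noteq> {} then ?g (?H ` B) else 0)
        = (if diff_flat n B = {} then 0 else (-1) ^ card B * t ^ affine_dim (diff_flat n B))"
      by (simp add: flat)
  qed simp
  finally show ?thesis .
qed

text \<open>The direction space solves the homogeneous system, so it consists of the vectors
  constant on components of the graph of \<open>B\<close>.\<close>

lemma affine_dim_diff_flat:
  assumes B: "B \<subseteq> diff_triples n A" and ne: "diff_flat n B \<noteq> {}"
  shows "affine_dim (diff_flat n B) =
    card (edge_class ((\<lambda>e. (fst e, fst (snd e))) ` B) ` {..<n})"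
proof -
  let ?E = "(\<lambda>e. (fst e, fst (snd e))) ` B"
  have E: "?E \<subseteq> {..<n} \<times> {..<n}" using B by (auto simp: diff_triples_def)
  obtain x where x: "x \<in> diff_flat n B" using ne by blast
  have "{x - y | x y. x \<in> diff_flat n B \<and> y \<in> diff_flat n B}
      = {z \<in> topspace (Euclidean_space n). \<forall>(i, j)\<in>?E. z i = z j}"
  proof (intro subset_antisym subsetI)
    fix z assume "z \<in> {x - y | x y. x \<in> diff_flat n B \<and> y \<in> diff_flat n B}"
    then obtain u w where uw: "z = u - w" "u \<in> diff_flat n B" "w \<in> diff_flat n B" by blast
    then have "z \<in> topspace (Euclidean_space n)"
      using subspace_diff[OF subspace_topspace_Euclidean_space] by (simp add: diff_flat_def)
    moreover have "z (fst e) = z (fst (snd e))" if "e \<in> B" for e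
    proof -
      have "u (fst e) - u (fst (snd e)) = w (fst e) - w (fst (snd e))"
        using uw(2,3) that by (simp add: diff_flat_def diff_form_def)
      then show ?thesis unfolding uw(1) by simp
    qed
    ultimately show "z \<in> {z \<in> topspace (Euclidean_space n). \<forall>(i, j)\<in>?E. z i = z j}" by auto
  next
    fix z assume z: "z \<in> {z \<in> topspace (Euclidean_space n). \<forall>(i, j)\<in>?E. z i = z j}"
    have "x + z \<in> topspace (Euclidean_space n)"
      using x z subspace_add[OF subspace_topspace_Euclidean_space] by (simp add: diff_flat_def)
    moreover have "diff_form e (x + z) = diff_const e" if "e \<in> B" for e
      using x z that by (auto simp: diff_flat_def diff_form_def)
    ultimately have "x + z \<in> diff_flat n B" by (simp add: diff_flat_def)
    moreover have "z = (x + z) - x" by simp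
    ultimately show "z \<in> {x - y | x y. x \<in> diff_flat n B \<and> y \<in> diff_flat n B}" using x by blast
  qed
  also have "\<dots> = fibre_constant n (edge_class ?E)"
    unfolding fibre_constant_def edge_constant_iff[OF E] ..
  finally show ?thesis by (simp add: affine_dim_def dim_fibre_constant)
qed

section \<open>Subarrangements attached to functions, and the double count\<close>

text \<open>Indexes the arrangement \<open>\<A>\<^sub>f\<close> of the overview. The name refers to
  the level sets of \<open>f\<close>, not to the level of a region.\<close>

definition level_triples :: "nat \<Rightarrow> real set \<Rightarrow> (nat \<Rightarrow> nat) \<Rightarrow> (nat \<times> nat \<times> real) set" where
  "level_triples n A f = {e \<in> diff_triples n A. f (fst e) = f (fst (snd e))}"

text \<open>The components of the graph of \<open>B\<close> determine both the functions and the
  dimension of the flat.\<close>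

lemma card_level_functions:
  assumes B: "B \<subseteq> diff_triples n A" and ne: "diff_flat n B \<noteq> {}"
  shows "card {f \<in> {..<n} \<rightarrow>\<^sub>E {..<k::nat}. B \<subseteq> level_triples n A f} =
    k ^ affine_dim (diff_flat n B)"
proof -
  let ?E = "(\<lambda>e. (fst e, fst (snd e))) ` B"
  have E: "?E \<subseteq> {..<n} \<times> {..<n}" using B by (auto simp: diff_triples_def)
  have "B \<subseteq> level_triples n A f \<longleftrightarrow> (\<forall>(i, j)\<in>?E. f i = f j)" for f
    using B by (auto simp: level_triples_def)
  then show ?thesis
    unfolding edge_constant_iff[OF E]
    by (simp add: card_fibre_constant_functions affine_dim_diff_flat[OF assms])
qed

text \<open>Intersection with \<open>level_triples n A f\<close> is the bijection. Its inverse moves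
  a point of a chamber of the subarrangement so that the blocks of \<open>f\<close> are far
  apart.\<close>

lemma card_chambers_level_triples:
  assumes A: "finite A" "A \<noteq> {}"
  shows "card (chambers diff_form diff_const (level_triples n A f) (topspace (Euclidean_space n)))
    = card {T \<in> diff_chambers n A. \<forall>(i, j)\<in>forced_edges n A T. f i \<le> f j}"
proof -
  let ?E = "topspace (Euclidean_space n)"
  let ?I = "diff_triples n A" and ?J = "level_triples n A f"
  let ?C = "{T \<in> diff_chambers n A. \<forall>(i, j)\<in>forced_edges n A T. f i \<le> f j}"
  have JI: "?J \<subseteq> ?I" by (auto simp: level_triples_def)
  have MM: "Min A \<in> A" "Max A \<in> A" using A by auto
  \<comment> \<open>Injectivity: when \<open>f\<close> takes different values at \<open>p\<close>
    and \<open>q\<close>, one of the two edges is forbidden, and this fixes the sign of every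
    hyperplane for that pair.\<close>
  have decomp: "T = (T \<inter> ?J) \<union> {e \<in> ?I. f (fst e) < f (fst (snd e))}" if T: "T \<in> ?C" for T
  proof -
    obtain x where x: "x \<in> diff_cell n A T" using T by (auto simp: chambers_def chamber_cell_def)
    have up: "(p, q, a) \<in> T" if pq: "p < q" "q < n" and a: "a \<in> A" and f: "f p < f q" for p q a
    proof -
      have "(q, p) \<notin> forced_edges n A T" using T f by force
      then have "Max A < x p - x q"
        using pq diff_cell_sign(1)[OF x pq MM(2)] by (auto simp: forced_edges_def)
      then show ?thesis
        using diff_cell_sign(1)[OF x pq a] Max_ge[OF A(1) a] by linarith
    qed
    have down: "(p, q, a) \<notin> T" if pq: "p < q" "q < n" and a: "a \<in> A" and f: "f q < f p" for p q a
    proof -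
      have "(p, q) \<notin> forced_edges n A T" using T f by force
      then have "x p - x q < Min A"
        using pq diff_cell_sign(2)[OF x pq MM(1)] by (auto simp: forced_edges_def)
      then show ?thesis
        using diff_cell_sign(2)[OF x pq a] Min_le[OF A(1) a] by linarith
    qed
    have "T \<subseteq> ?I" using T by (auto simp: chambers_def positive_set_def)
    moreover have "e \<in> T \<longleftrightarrow> e \<in> T \<inter> ?J \<or> f (fst e) < f (fst (snd e))" if e: "e \<in> ?I" for e
    proof -
      obtain p q a where [simp]: "e = (p, q, a)" by (cases e) auto
      have "p < q" "q < n" "a \<in> A" using e by (auto simp: diff_triples_def)
      then show ?thesis
        using up[of p q a] down[of p q a] e
        by (cases "f p" "f q" rule: linorder_cases) (auto simp: level_triples_def)
    qed
    ultimately show ?thesis by blast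
  qed
  have "bij_betw (\<lambda>T. T \<inter> ?J) ?C (chambers diff_form diff_const ?J ?E)"
  proof (rule bij_betw_imageI)
    show "inj_on (\<lambda>T. T \<inter> ?J) ?C"
      by (rule inj_onI) (metis (no_types, lifting) decomp)
    show "(\<lambda>T. T \<inter> ?J) ` ?C = chambers diff_form diff_const ?J ?E"
    proof (intro subset_antisym subsetI)
      fix T' assume "T' \<in> (\<lambda>T. T \<inter> ?J) ` ?C"
      then obtain x where "x \<in> ?E" "\<forall>e\<in>?I. diff_form e x \<noteq> diff_const e"
        "T' = positive_set diff_form diff_const ?I x \<inter> ?J"
        by (auto simp: chambers_def)
      then show "T' \<in> chambers diff_form diff_const ?J ?E"
        using JI by (auto simp: chambers_def positive_set_def intro!: image_eqI[of _ _ x])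
    next
      fix T' assume "T' \<in> chambers diff_form diff_const ?J ?E"
      then obtain x where x: "x \<in> ?E" "\<forall>e\<in>?J. diff_form e x \<noteq> diff_const e"
        "T' = positive_set diff_form diff_const ?J x"
        by (auto simp: chambers_def)
      \<comment> \<open>One unit of \<open>f\<close> scaled by \<open>M\<close> outweighs every
        offset \<open>x p - x q - a\<close>; the \<open>+ 1\<close> makes this strict.\<close>
      define M where "M = (\<Sum>e\<in>?I. \<bar>diff_form e x - diff_const e\<bar>) + 1"
      have M: "\<bar>x p - x q - a\<bar> < M" if "p < q" "q < n" "a \<in> A" for p q a
      proof -
        have "\<bar>diff_form (p, q, a) x - diff_const (p, q, a)\<bar>
            \<le> (\<Sum>e\<in>?I. \<bar>diff_form e x - diff_const e\<bar>)"
          using that A(1)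
          by (intro member_le_sum)
            (auto simp: diff_triples_def finite_diff_triples[unfolded diff_triples_def])
        then show ?thesis by (simp add: M_def diff_form_def diff_const_def)
      qed
      have "M \<ge> 0" by (simp add: M_def sum_nonneg add_nonneg_nonneg)
      \<comment> \<open>Larger \<open>f\<close> means a smaller coordinate, in keeping with edges
        pointing from larger to smaller coordinates of ray directions. Differences inside a block of
        \<open>f\<close> do not change.\<close>
      define y where "y i = (if i < n then x i - M * real (f i) else 0)" for i
      have y_E: "y \<in> ?E" by (simp add: y_def topspace_Euclidean_space)
      have y_diff: "y p - y q = x p - x q + M * (real (f q) - real (f p))" if "p < q" "q < n" for p q
        using that by (simp add: y_def algebra_simps)
      have up: "a < y p - y q" if "p < q" "q < n" "a \<in> A" "f p < f q" for p q a
      proof -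
        have "M * 1 \<le> M * (real (f q) - real (f p))"
          using that \<open>M \<ge> 0\<close> by (intro mult_left_mono) auto
        then show ?thesis using M[OF that(1-3)] y_diff[OF that(1,2)] by linarith
      qed
      have down: "y p - y q < a" if "p < q" "q < n" "a \<in> A" "f q < f p" for p q a
      proof -
        have "M * (real (f q) - real (f p)) \<le> M * (- 1)"
          using that \<open>M \<ge> 0\<close> by (intro mult_left_mono) auto
        then show ?thesis using M[OF that(1-3)] y_diff[OF that(1,2)] by linarith
      qed
      have same: "diff_form e y = diff_form e x" if "e \<in> ?J" for e
        using that y_diff[of "fst e" "fst (snd e)"]
        by (auto simp: level_triples_def diff_triples_def diff_form_def)
      have generic: "diff_form e y \<noteq> diff_const e" if e: "e \<in> ?I" for e
      proof -
        obtain p q a where [simp]: "e = (p, q, a)" by (cases e) auto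
        have "p < q" "q < n" "a \<in> A" using e by (auto simp: diff_triples_def)
        then show ?thesis
          using up[of p q a] down[of p q a] same[of e] x(2) e
          by (cases "f p" "f q" rule: linorder_cases)
            (auto simp: level_triples_def diff_form_def diff_const_def)
      qed
      let ?T = "positive_set diff_form diff_const ?I y"
      have T: "?T \<in> diff_chambers n A" using y_E generic by (auto simp: chambers_def)
      have y_cell: "y \<in> diff_cell n A ?T" using y_E generic by (auto simp: chamber_cell_def)
      have "f i \<le> f j" if ij: "(i, j) \<in> forced_edges n A ?T" for i j
      proof (rule ccontr)
        assume f: "\<not> f i \<le> f j"
        have n: "i < n" "j < n" using ij by (auto simp: forced_edges_def)
        consider "i < j" "(i, j, Min A) \<in> ?T" | "j < i" "(j, i, Max A) \<notin> ?T"
          using ij by (auto simp: forced_edges_def)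
        then show False
        proof cases
          case 1
          then show False
            using diff_cell_sign(1)[OF y_cell 1(1) n(2) MM(1)] down[OF 1(1) n(2) MM(1)] f by auto
        next
          case 2
          then show False
            using diff_cell_sign(2)[OF y_cell 2(1) n(1) MM(2)] up[OF 2(1) n(1) MM(2)] f by auto
        qed
      qed
      then have "?T \<in> ?C" using T by blast
      moreover have "T' = ?T \<inter> ?J"
        unfolding x(3) using same JI by (auto simp: positive_set_def)
      ultimately show "T' \<in> (\<lambda>T. T \<inter> ?J) ` ?C" by blast
    qed
  qed
  then show ?thesis by (simp add: bij_betw_same_card)
qed

lemma signed_flat_Euclidean_space: "signed_flat (topspace (Euclidean_space n)) = (-1) ^ n"
proof -
  let ?E = "topspace (Euclidean_space n)"
  have "0 \<in> ?E" by (simp add: topspace_Euclidean_space)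
  then have "{x - y | x y. x \<in> ?E \<and> y \<in> ?E} = ?E"
    using subspace_diff[OF subspace_topspace_Euclidean_space[of n]] by force
  then have "affine_dim ?E = n"
    using dim_fibre_constant[of n "\<lambda>i. i"]
    by (simp add: affine_dim_def flip: topspace_Euclidean_space_fibre)
  then show ?thesis using \<open>0 \<in> ?E\<close> by (auto simp: signed_flat_def)
qed

lemma affine_topspace_Euclidean_space: "affine (topspace (Euclidean_space n))"
  by (rule subspace_imp_affine[OF subspace_topspace_Euclidean_space])

text \<open>A double count: the power of \<open>k\<close> becomes a sum over functions,
  \<open>zaslavsky\<close> evaluates the sum over subarrangements for each function, and the
  functions are then counted chamber by chamber.\<close>

lemma poly_arrangement_poly_neg:
  assumes A: "finite A" "A \<noteq> {}"
  shows "poly (arrangement_poly n (difference_arrangement n A)) (- real k) =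
    (-1) ^ n * (\<Sum>T\<in>diff_chambers n A.
      real ((k + level n (diff_cell n A T) - 1) choose level n (diff_cell n A T)))"
proof -
  let ?I = "diff_triples n A" and ?J = "level_triples n A"
  let ?E = "topspace (Euclidean_space n)"
  let ?F = "{..<n} \<rightarrow>\<^sub>E {..<k}"
  let ?w = "\<lambda>B. (-1) ^ card B * signed_flat (diff_flat n B)"
  have finI: "finite ?I" using A by (simp add: finite_diff_triples)
  have finF: "finite ?F" by (simp add: finite_PiE)
  have finC: "finite (diff_chambers n A)" by (rule finite_chambers[OF finI])
  have "poly (arrangement_poly n (difference_arrangement n A)) (- real k)
      = (\<Sum>B\<in>Pow ?I. \<Sum>f | f \<in> ?F \<and> B \<subseteq> ?J f. ?w B)"
    unfolding poly_arrangement_poly_diff[OF A(1)]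
  proof (rule sum.cong)
    fix B assume "B \<in> Pow ?I"
    then have B: "B \<subseteq> ?I" by simp
    show "(if diff_flat n B = {} then 0 else (-1) ^ card B * (- real k) ^ affine_dim (diff_flat n B))
        = (\<Sum>f | f \<in> ?F \<and> B \<subseteq> ?J f. ?w B)"
    proof (cases "diff_flat n B = {}")
      case False
      have "(- real k) ^ affine_dim (diff_flat n B)
          = signed_flat (diff_flat n B) * real (k ^ affine_dim (diff_flat n B))"
        using False by (simp add: signed_flat_def power_minus[of "real k"])
      then show ?thesis using False card_level_functions[OF B False, of k] by simp
    qed (simp add: signed_flat_def)
  qed simp
  \<comment> \<open>For a fixed \<open>f\<close> the sum over \<open>B\<close> becomes the Zaslavsky
    sum of \<open>level_triples n A f\<close>.\<close>
  also have "\<dots> = (\<Sum>f\<in>?F. \<Sum>B | B \<in> Pow ?I \<and> B \<subseteq> ?J f. ?w B)"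
    by (rule sum.swap_restrict) (use finI finF in auto)
  also have "\<dots> = (\<Sum>f\<in>?F. \<Sum>B\<in>Pow (?J f). ?w B)"
    by (intro sum.cong) (auto simp: level_triples_def)
  also have "\<dots> = (\<Sum>f\<in>?F. (-1) ^ n * real (card (chambers diff_form diff_const (?J f) ?E)))"
  proof (rule sum.cong)
    fix f
    have "finite (?J f)" using finI by (simp add: level_triples_def)
    from zaslavsky[OF this affine_topspace_Euclidean_space subset_refl linear_diff_form]
    show "(\<Sum>B\<in>Pow (?J f). ?w B) = (-1) ^ n * real (card (chambers diff_form diff_const (?J f) ?E))"
      by (simp add: signed_flat_Euclidean_space diff_flat_def)
  qed simp
  also have "\<dots> = (-1) ^ n * real (\<Sum>f\<in>?F. \<Sum>T | T \<in> diff_chambers n A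
      \<and> (\<forall>(i, j)\<in>forced_edges n A T. f i \<le> f j). 1)"
    by (simp add: card_chambers_level_triples[OF A] sum_distrib_left)
  \<comment> \<open>The second exchange leaves, for each chamber, the weakly increasing functions on
    its digraph.\<close>
  also have "(\<Sum>f\<in>?F. \<Sum>T | T \<in> diff_chambers n A \<and> (\<forall>(i, j)\<in>forced_edges n A T. f i \<le> f j). 1)
      = (\<Sum>T\<in>diff_chambers n A. \<Sum>f | f \<in> ?F \<and> (\<forall>(i, j)\<in>forced_edges n A T. f i \<le> f j). 1 :: nat)"
    by (rule sum.swap_restrict[OF finF finC])
  also have "\<dots> = (\<Sum>T\<in>diff_chambers n A.
      (k + level n (diff_cell n A T) - 1) choose level n (diff_cell n A T))"
    by (rule sum.cong) (simp_all add: card_mono_functions_eq_level[OF A])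
  finally show ?thesis by simp
qed

section \<open>Grouping by level and comparison of polynomials\<close>

lemma num_regions_diff:
  "num_regions n (difference_arrangement n A) l =
    card {T \<in> diff_chambers n A. level n (diff_cell n A T) = l}"
proof -
  have "regions n (difference_arrangement n A) = diff_cell n A ` diff_chambers n A"
    unfolding difference_arrangement_eq diff_hyperplane_def
    by (rule regions_eq_chamber_cells) (simp_all add: linear_diff_form continuous_map_diff_form)
  then have "{R \<in> regions n (difference_arrangement n A). level n R = l}
      = diff_cell n A ` {T \<in> diff_chambers n A. level n (diff_cell n A T) = l}"
    by auto
  moreover have "inj_on (diff_cell n A) {T \<in> diff_chambers n A. level n (diff_cell n A T) = l}"
    by (rule inj_on_subset[OF inj_on_chamber_cell]) auto
  ultimately show ?thesis unfolding num_regions_def by (simp add: card_image)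
qed

text \<open>Chambers are grouped by level; the range up to \<open>n\<close> suffices because no
  level exceeds \<open>n\<close>.\<close>

lemma sum_num_regions:
  assumes A: "finite A" "A \<noteq> {}"
  shows "(\<Sum>l=0..n. g l * real (num_regions n (difference_arrangement n A) l)) =
    (\<Sum>T\<in>diff_chambers n A. g (level n (diff_cell n A T)))"
proof -
  have fin: "finite (diff_chambers n A)" using A by (intro finite_chambers finite_diff_triples)
  have "(\<Sum>T\<in>diff_chambers n A. g (level n (diff_cell n A T)))
      = (\<Sum>l\<in>{0..n}. \<Sum>T | T \<in> diff_chambers n A \<and> level n (diff_cell n A T) = l.
          g (level n (diff_cell n A T)))"
    by (rule sum.group[symmetric]) (use fin card_mono_functions_eq_level(1)[OF A] in auto)
  also have "\<dots> = (\<Sum>l=0..n. g l * real (num_regions n (difference_arrangement n A) l))"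
    by (rule sum.cong) (simp_all add: num_regions_diff)
  finally show ?thesis by simp
qed

lemma expansion_at_negative_integers:
  assumes A: "finite A" "A \<noteq> {}"
  shows "poly (arrangement_poly n (difference_arrangement n A)) (- real (Suc k)) =
    (\<Sum>l=0..n. (-1) ^ (n - l) * real (num_regions n (difference_arrangement n A) l)
      * (- real (Suc k) gchoose l))"
proof -
  define g where "g l = (-1) ^ (n - l) * (- real (Suc k) gchoose l)" for l
  have gch: "- real (Suc k) gchoose l = (-1) ^ l * real ((Suc k + l - 1) choose l)" for l
  proof -
    \<comment> \<open>With \<open>Suc k\<close> the natural-number subtraction is never truncated,
      even for \<open>l = 0\<close>.\<close>
    have "real l - (- real (Suc k)) - 1 = real (Suc k + l - 1)" by simp
    then show ?thesis
      unfolding gbinomial_negated_upper[of "- real (Suc k)"] binomial_gbinomial by metis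
  qed
  \<comment> \<open>The signs \<open>(-1) ^ (n - l)\<close> and \<open>(-1) ^ l\<close> combine to
    \<open>(-1) ^ n\<close>, independent of the level.\<close>
  have g: "g l = (-1) ^ n * real ((Suc k + l - 1) choose l)" if "l \<le> n" for l
    unfolding g_def gch using that by (simp add: mult.assoc[symmetric] flip: power_add)
  have "(\<Sum>l=0..n. (-1) ^ (n - l) * real (num_regions n (difference_arrangement n A) l)
      * (- real (Suc k) gchoose l))
      = (\<Sum>l=0..n. g l * real (num_regions n (difference_arrangement n A) l))"
    by (simp add: g_def mult_ac)
  also have "\<dots> = (\<Sum>T\<in>diff_chambers n A. g (level n (diff_cell n A T)))"
    by (rule sum_num_regions[OF A])
  also have "\<dots> = poly (arrangement_poly n (difference_arrangement n A)) (- real (Suc k))"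
    unfolding poly_arrangement_poly_neg[OF A] sum_distrib_left
    by (rule sum.cong) (simp_all only: g card_mono_functions_eq_level(1)[OF A])
  finally show ?thesis by simp
qed

lemma gbinomial_poly: "\<exists>p. \<forall>t::real. poly p t = (t gchoose l)"
proof -
  have "poly (smult (1 / fact l) (\<Prod>i=0..<l. [:- of_nat i, 1:])) t = (t gchoose l)" for t :: real
    by (simp add: gbinomial_prod_rev poly_prod)
  then show ?thesis by blast
qed

theorem theorem1p2:
  fixes A :: "real set" and n :: nat and t :: real
  assumes "finite A" and "A \<noteq> {}"
  shows "poly (arrangement_poly n (difference_arrangement n A)) t =
    (\<Sum>l=0..n. (-1) ^ (n - l) * real (num_regions n (difference_arrangement n A) l) * (t gchoose l))"
proof -
  obtain q :: "nat \<Rightarrow> real poly" where q: "\<And>l t. poly (q l) t = (t gchoose l)"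
    using gbinomial_poly by metis
  define P where "P = arrangement_poly n (difference_arrangement n A)"
  define Q where "Q = (\<Sum>l=0..n.
    smult ((-1) ^ (n - l) * real (num_regions n (difference_arrangement n A) l)) (q l))"
  have Q: "poly Q t =
    (\<Sum>l=0..n. (-1) ^ (n - l) * real (num_regions n (difference_arrangement n A) l) * (t gchoose l))" for t
    by (simp add: Q_def poly_sum q)
  \<comment> \<open>Agreement at all negative integers gives \<open>P - Q\<close> infinitely many
    roots.\<close>
  have "range (\<lambda>k. - real (Suc k)) \<subseteq> {t. poly (P - Q) t = 0}"
    using expansion_at_negative_integers[OF assms, of n] by (auto simp: P_def Q simp del: of_nat_Suc)
  moreover have "infinite (range (\<lambda>k. - real (Suc k)))"
    by (intro range_inj_infinite) (auto simp: inj_def)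
  ultimately have "infinite {t. poly (P - Q) t = 0}" using finite_subset by blast
  then have "P - Q = 0" using poly_roots_finite by blast
  then show ?thesis by (simp add: P_def flip: Q)
qed

end
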